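(* Let $G$ be a Frobenius group whose Frobenius complement and Frobenius kernel are both abelian; let $h$ and $k$ be the orders of the complement and the kernel, respectively. Then $$\mathrm{AM}_{\mathrm Z}(G) = 1 + 2\cdot\frac{h^2-1}{h}\left(1-\frac{h-1}{k}\right)\left(1-\frac1k\right).$$
   Context: All characters are complex characters. For a finite group $G$: $\mathrm{Irr}(G)$ is the set of irreducible characters of $G$, $d_\chi$ is the degree of $\chi$, $\mathrm{Conj}(G)$ is the set of conjugacy classes of $G$, and $\chi(C)$ is the common value of $\chi$ on the elements of a conjugacy class $C$. The ZL-amenability constant of a finite group $G$ (the amenability constant of the centre of $\ell^1(G)$) is $$\mathrm{AM}_{\mathrm Z}(G) = \frac{1}{|G|^2}\sum_{C,D\in \mathrm{Conj}(G)} \left| \sum_{\chi\in \mathrm{Irr}(G)} d_\chi^2\, \chi(C)\overline{\chi(D)} \right| \, |C|\,|D|.$$ A finite group $G$ is a Frobenius group if it has a proper, non-trivial subgroup $H$ which is malnormal, i.e. $H\cap gHg^{-1}=\{e\}$ for all $g\in G\setminus H$; such an $H$ is called a Frobenius complement in $G$. The corresponding Frobenius kernel is $K = \left(G\setminus\bigcup_{g\in G} gHg^{-1}\right)\cup\{e\}$; by a theorem of Frobenius, $K$ is a normal subgroup of $G$ and $G = K\rtimes H$. *)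

theory Defs
  imports
    Complex_Main
    "HOL-Algebra.Group_Action"
    "Jordan_Normal_Form.VS_Connect"
begin

section \<open>Complex characters of a group\<close>

definition GL :: "nat \<Rightarrow> complex mat monoid" where
  "GL n = units_of (ring_mat TYPE(complex) n ())"

definition irreducible_rep ::
  "('a, 'b) monoid_scheme \<Rightarrow> nat \<Rightarrow> ('a \<Rightarrow> complex mat) \<Rightarrow> bool" where
  "irreducible_rep G n \<rho> \<longleftrightarrow>
     \<rho> \<in> hom G (GL n) \<and> n > 0 \<and>
     (\<forall>W. VectorSpace.subspace class_ring W (module_vec TYPE(complex) n) \<longrightarrow>
          (\<forall>g\<in>carrier G. \<forall>w\<in>W. \<rho> g *\<^sub>v w \<in> W) \<longrightarrow>
          W = {0\<^sub>v n} \<or> W = carrier_vec n)"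

definition mat_trace :: "complex mat \<Rightarrow> complex" where
  "mat_trace A = (\<Sum>i<dim_row A. A $$ (i, i))"

text \<open>
  Characters are made extensional: the values of a homomorphism outside the carrier are
  arbitrary, and without the restriction a single character would give rise to many functions.
\<close>

definition character_of ::
  "('a, 'b) monoid_scheme \<Rightarrow> ('a \<Rightarrow> complex mat) \<Rightarrow> 'a \<Rightarrow> complex" where
  "character_of G \<rho> = (\<lambda>g\<in>carrier G. mat_trace (\<rho> g))"

definition Irr :: "('a, 'b) monoid_scheme \<Rightarrow> ('a \<Rightarrow> complex) set" where
  "Irr G = {character_of G \<rho> | \<rho> n. irreducible_rep G n \<rho>}"

definition char_degree :: "('a, 'b) monoid_scheme \<Rightarrow> ('a \<Rightarrow> complex) \<Rightarrow> complex" where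
  "char_degree G \<chi> = \<chi> \<one>\<^bsub>G\<^esub>"


section \<open>Conjugacy classes and the ZL-amenability constant\<close>

definition Conj :: "('a, 'b) monoid_scheme \<Rightarrow> 'a set set" where
  "Conj G = orbits G (carrier G) (\<lambda>g. \<lambda>x\<in>carrier G. g \<otimes>\<^bsub>G\<^esub> x \<otimes>\<^bsub>G\<^esub> inv\<^bsub>G\<^esub> g)"

text \<open>The common value of \<open>\<chi>\<close> on \<open>C\<close>; meaningful since characters are class functions.\<close>

definition value_on :: "('a \<Rightarrow> complex) \<Rightarrow> 'a set \<Rightarrow> complex" where
  "value_on \<chi> C = the_elem (\<chi> ` C)"

definition AM_Z :: "('a, 'b) monoid_scheme \<Rightarrow> real" where
  "AM_Z G = 1 / real (Coset.order G) ^ 2 *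
     (\<Sum>C\<in>Conj G. \<Sum>D\<in>Conj G.
        cmod (\<Sum>\<chi>\<in>Irr G. char_degree G \<chi> ^ 2 * value_on \<chi> C * cnj (value_on \<chi> D))
        * real (card C) * real (card D))"


section \<open>Frobenius groups\<close>

definition conj_set :: "('a, 'b) monoid_scheme \<Rightarrow> 'a \<Rightarrow> 'a set \<Rightarrow> 'a set" where
  "conj_set G g H = g <#\<^bsub>G\<^esub> H #>\<^bsub>G\<^esub> inv\<^bsub>G\<^esub> g"

definition malnormal :: "'a set \<Rightarrow> ('a, 'b) monoid_scheme \<Rightarrow> bool" where
  "malnormal H G \<longleftrightarrow> (\<forall>g\<in>carrier G - H. H \<inter> conj_set G g H = {\<one>\<^bsub>G\<^esub>})"

definition frobenius_complement :: "'a set \<Rightarrow> ('a, 'b) monoid_scheme \<Rightarrow> bool" where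
  "frobenius_complement H G \<longleftrightarrow>
     subgroup H G \<and> H \<noteq> carrier G \<and> H \<noteq> {\<one>\<^bsub>G\<^esub>} \<and> malnormal H G"

definition frobenius_kernel :: "'a set \<Rightarrow> ('a, 'b) monoid_scheme \<Rightarrow> 'a set" where
  "frobenius_kernel H G = (carrier G - (\<Union>g\<in>carrier G. conj_set G g H)) \<union> {\<one>\<^bsub>G\<^esub>}"

text \<open>
  Commutativity of a set of elements. For a subgroup this says that it is abelian; for the
  Frobenius kernel it does not presuppose Frobenius' theorem that the kernel is a subgroup.
\<close>

definition commutative_on :: "'a set \<Rightarrow> ('a, 'b) monoid_scheme \<Rightarrow> bool" where
  "commutative_on A G \<longleftrightarrow> (\<forall>x\<in>A. \<forall>y\<in>A. x \<otimes>\<^bsub>G\<^esub> y = y \<otimes>\<^bsub>G\<^esub> x)"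

end

theory Submission
  imports Defs "HOL-Algebra.Multiplicative_Group" "HOL-Computational_Algebra.Fundamental_Theorem_Algebra"
begin

text \<open>
  Since class sums weighted by class sizes are sums over the group, \<open>AM_Z G\<close> is \<open>1 / |G|\<^sup>2\<close> times the
  sum over pairs \<open>g, g'\<close> in \<open>G\<close> of \<open>|S(g, g')|\<close>, where \<open>S(g, g')\<close> is the sum of
  \<open>d\<^sub>\<chi>\<^sup>2 \<chi>(g) cnj (\<chi>(g'))\<close> over the irreducible characters.
  The irreducible characters of a Frobenius group \<open>K \<rtimes> H\<close> with \<open>K\<close> and \<open>H\<close> abelian are the
  \<open>h\<close> linear characters lifted from \<open>H\<close> and the characters of degree \<open>h\<close> induced from the nonprincipal
  characters of \<open>K\<close>, each arising from exactly \<open>h\<close> of them because \<open>H\<close> acts freely on the nonprincipal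
  characters. Orthogonality in \<open>H\<close> and \<open>K\<close> therefore evaluates \<open>S(g, g')\<close> in terms of the number of
  elements of \<open>H\<close> conjugating \<open>g'\<close> to \<open>g\<close>.

  That \<open>K\<close> is a subgroup does not need Frobenius' theorem here: if \<open>x, y \<in> K\<close> commute and
  \<open>x y\<close> were a nontrivial element of a conjugate of \<open>H\<close>, then \<open>x\<close>, which centralises \<open>x y\<close>, would lie in that
  conjugate too, so \<open>x = 1\<close> and \<open>y = x y\<close> would not be in \<open>K\<close>.
\<close>

section \<open>Characters of finite abelian subgroups\<close>

text \<open>Since \<open>Irr\<close> is defined by irreducible matrix representations, the list of
  characters is obtained and shown complete from representations, without counting squared degrees.
  Averaging a nonzero vector against the characters of K yields a common eigenvector of K. Its
  translates under H, or one further average over H when K fixes it, give a nonzero intertwiner from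
  an induced or a lifted representation, and Schur's lemma then identifies the traces.

  The factorisation G = HK comes from counting: all nontrivial conjugates of elements of H are hit
  equally often, which gives |H| |K| = |G|, and H meets K trivially.

  The shape of the formula is decided by signs. On K the sum S equals h + h^2 (k c - h), where c is
  the number of conjugating elements; this is negative exactly for c = 0. Positivity for c = 1 uses
  that k exceeds h, which holds because H acts freely on the nontrivial elements of K. Off K, S is h
  for two elements of the same coset of K; for elements of different cosets it is 0.\<close>

lemma (in group) mult_inv_cancel_left:
  "x \<in> carrier G \<Longrightarrow> y \<in> carrier G \<Longrightarrow> x \<otimes> (inv x \<otimes> y) = y"
  by (simp add: m_assoc[symmetric])

lemma (in group) inv_mult_cancel_left:
  "x \<in> carrier G \<Longrightarrow> y \<in> carrier G \<Longrightarrow> inv x \<otimes> (x \<otimes> y) = y"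
  by (simp add: m_assoc[symmetric])

text \<open>The characters of \<open>A\<close> are extended by \<open>0\<close> off \<open>A\<close>, so that the formula for an induced
  character needs no case distinction.\<close>

definition dual :: "('a, 'b) monoid_scheme \<Rightarrow> 'a set \<Rightarrow> ('a \<Rightarrow> complex) set" where
  "dual G A = {\<chi>. (\<forall>x. x \<notin> A \<longrightarrow> \<chi> x = 0) \<and> \<chi> \<one>\<^bsub>G\<^esub> = 1 \<and>
     (\<forall>x\<in>A. \<forall>y\<in>A. \<chi> (x \<otimes>\<^bsub>G\<^esub> y) = \<chi> x * \<chi> y)}"

text \<open>Working inside an ambient group lets K, H and the intermediate subgroups of an extension
  argument share one multiplication.\<close>

locale finite_abelian_subgroup = group G for G (structure) +
  fixes A
  assumes sub: "subgroup A G" and fin: "finite A"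
    and comm: "\<And>x y. x \<in> A \<Longrightarrow> y \<in> A \<Longrightarrow> x \<otimes> y = y \<otimes> x"
begin

lemma mem_carrier [simp]: "x \<in> A \<Longrightarrow> x \<in> carrier G"
  using sub subgroup.subset by blast

lemma one_mem [simp]: "\<one> \<in> A"
  using sub subgroup.one_closed by blast

lemma mult_mem [simp]: "x \<in> A \<Longrightarrow> y \<in> A \<Longrightarrow> x \<otimes> y \<in> A"
  using sub subgroup.m_closed by metis

lemma inv_mem [simp]: "x \<in> A \<Longrightarrow> inv x \<in> A"
  using sub subgroup.m_inv_closed by metis

lemma pow_mem [simp]: "x \<in> A \<Longrightarrow> x [^] (n::nat) \<in> A"
  by (induction n) auto

lemma card_pos [simp]: "card A > 0"
  using fin one_mem card_gt_0_iff by blast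

lemma pow_card: "x \<in> A \<Longrightarrow> x [^] card A = \<one>"
proof -
  assume x: "x \<in> A"
  interpret S: group "G\<lparr>carrier := A\<rparr>"
    using sub subgroup.subgroup_is_group group_axioms by blast
  have "x [^]\<^bsub>G\<lparr>carrier := A\<rparr>\<^esub> Coset.order (G\<lparr>carrier := A\<rparr>) = \<one>\<^bsub>G\<lparr>carrier := A\<rparr>\<^esub>"
    using S.pow_order_eq_1 x by simp
  then show ?thesis
    by (simp add: Coset.order_def nat_pow_consistent[symmetric])
qed

lemma dual_one: "\<chi> \<in> dual G A \<Longrightarrow> \<chi> \<one> = 1"
  by (simp add: dual_def)

lemma dual_zero: "\<chi> \<in> dual G A \<Longrightarrow> x \<notin> A \<Longrightarrow> \<chi> x = 0"
  by (simp add: dual_def)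

lemma dual_mult: "\<chi> \<in> dual G A \<Longrightarrow> x \<in> A \<Longrightarrow> y \<in> A \<Longrightarrow> \<chi> (x \<otimes> y) = \<chi> x * \<chi> y"
  by (simp add: dual_def)

lemma dual_pow: "\<chi> \<in> dual G A \<Longrightarrow> x \<in> A \<Longrightarrow> \<chi> (x [^] (n::nat)) = \<chi> x ^ n"
  by (induction n) (auto simp: dual_one dual_mult)

lemma dual_root_of_unity: "\<chi> \<in> dual G A \<Longrightarrow> x \<in> A \<Longrightarrow> \<chi> x ^ card A = 1"
  by (metis dual_one dual_pow pow_card)

lemma dual_norm: "\<chi> \<in> dual G A \<Longrightarrow> x \<in> A \<Longrightarrow> cmod (\<chi> x) = 1"
  using dual_root_of_unity[of \<chi> x] power_eq_1_iff[of "\<chi> x" "card A"] card_pos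
  by (metis less_irrefl_nat)

lemma dual_cnj: 
  assumes "\<chi> \<in> dual G A" "x \<in> A" 
  shows "cnj (\<chi> x) = \<chi> (inv x)"
proof -
  have "\<chi> x * \<chi> (inv x) = 1"
    using assms by (metis dual_mult dual_one inv_mem mem_carrier r_inv)
  moreover have "\<chi> x * cnj (\<chi> x) = 1"
    using dual_norm[OF assms] by (simp add: complex_norm_square[symmetric])
  ultimately show ?thesis
    by (metis mult_cancel_left mult_zero_left zero_neq_one)
qed

text \<open>Values on \<open>A\<close> are roots of unity of order dividing \<open>card A\<close>,
  and the value off \<open>A\<close> is fixed, so only finitely many functions remain.\<close>

lemma finite_dual: "finite (dual G A)"
proof (rule finite_subset)
  show "dual G A \<subseteq> {\<chi>. \<forall>x. (x \<in> A \<longrightarrow> \<chi> x \<in> {z. z ^ card A = 1}) \<and> (x \<notin> A \<longrightarrow> \<chi> x = 0)}"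
    using dual_root_of_unity dual_zero by auto
  show "finite {\<chi>. \<forall>x. (x \<in> A \<longrightarrow> \<chi> x \<in> {z :: complex. z ^ card A = 1}) \<and> (x \<notin> A \<longrightarrow> \<chi> x = 0)}"
    using fin finite_roots_unity[of "card A"] by (intro finite_set_of_finite_funs) (auto simp: Suc_le_eq)
qed

lemma sum_translate: "x \<in> A \<Longrightarrow> (\<Sum>y\<in>A. f (x \<otimes> y)) = (\<Sum>y\<in>A. f y)"
  by (rule sum.reindex_bij_witness[where i="\<lambda>y. inv x \<otimes> y" and j="\<lambda>y. x \<otimes> y"])
     (auto simp: m_assoc[symmetric])

text \<open>Translation by an element with \<open>\<chi> x \<noteq> 1\<close> multiplies the sum by
  \<open>\<chi> x\<close>, so it must vanish.\<close>

lemma sum_dual: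
  assumes "\<chi> \<in> dual G A"
  shows "(\<Sum>x\<in>A. \<chi> x) = (if \<forall>x\<in>A. \<chi> x = 1 then of_nat (card A) else 0)"
proof (cases "\<forall>x\<in>A. \<chi> x = 1")
  case False
  then obtain x where x: "x \<in> A" "\<chi> x \<noteq> 1" by blast
  have "(\<Sum>y\<in>A. \<chi> y) = (\<Sum>y\<in>A. \<chi> (x \<otimes> y))"
    using sum_translate[OF x(1)] by metis
  also have "\<dots> = \<chi> x * (\<Sum>y\<in>A. \<chi> y)"
    using assms x by (simp add: dual_mult sum_distrib_left)
  finally show ?thesis using x False by auto
qed auto

lemma row_orthogonality:
  assumes "\<chi> \<in> dual G A" "\<mu> \<in> dual G A"
  shows "(\<Sum>x\<in>A. \<chi> x * cnj (\<mu> x)) = (if \<chi> = \<mu> then of_nat (card A) else 0)"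
proof -
  have d: "(\<lambda>x. \<chi> x * cnj (\<mu> x)) \<in> dual G A"
    using assms by (auto simp: dual_def)
  have "\<chi> x * cnj (\<mu> x) = 1 \<longleftrightarrow> \<chi> x = \<mu> x" if "x \<in> A" for x
  proof -
    have "\<mu> x * cnj (\<mu> x) = 1" using dual_norm[OF assms(2) that] by (simp add: complex_norm_square[symmetric])
    then show ?thesis by (metis mult_right_cancel mult_zero_right zero_neq_one)
  qed
  then have "(\<forall>x\<in>A. \<chi> x * cnj (\<mu> x) = 1) \<longleftrightarrow> \<chi> = \<mu>"
    using assms by (auto simp: fun_eq_iff) (metis dual_zero)
  then show ?thesis using sum_dual[OF d] by simp
qed

text \<open>With \<open>n\<close> the order of \<open>b\<close> modulo \<open>B\<close>, the only
  constraint on the value \<open>c\<close> at \<open>b\<close> is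
  \<open>c ^ n = \<chi> (b [^] n)\<close>. All admissible \<open>c\<close> are offered: extending to
  \<open>A\<close> needs just one, but separating points needs one different from 1.\<close>

lemma dual_extend:
  assumes B: "subgroup B G" "B \<subseteq> A" and \<chi>: "\<chi> \<in> dual G B" and b: "b \<in> A" "b \<notin> B"
  shows "\<exists>n::nat. n \<ge> 2 \<and> b [^] n \<in> B \<and> (\<forall>c. c ^ n = \<chi> (b [^] n) \<longrightarrow>
       (\<exists>B' \<chi>'. subgroup B' G \<and> B' \<subseteq> A \<and> B \<subset> B' \<and> \<chi>' \<in> dual G B' \<and>
         (\<forall>x\<in>B. \<chi>' x = \<chi> x) \<and> \<chi>' b = c))"
proof -
  interpret B: finite_abelian_subgroup G B
  proof (intro finite_abelian_subgroup.intro finite_abelian_subgroup_axioms.intro)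
    show "group G" by (rule is_group)
    show "subgroup B G" "finite B" using B fin by (auto intro: finite_subset)
    show "x \<otimes> y = y \<otimes> x" if "x \<in> B" "y \<in> B" for x y
      using that B(2) by (intro comm) auto
  qed
  define n where "n = (LEAST n::nat. n > 0 \<and> b [^] n \<in> B)"
  have "\<exists>n::nat. n > 0 \<and> b [^] n \<in> B"
    using pow_card[OF b(1)] B.one_mem card_pos by metis
  then have n: "n > 0 \<and> b [^] n \<in> B"
    unfolding n_def by (rule LeastI_ex)
  have least: "m \<ge> n" if "m > 0" "b [^] m \<in> B" for m :: nat
    unfolding n_def using that by (intro Least_le) simp
  have "n \<noteq> 1" using n b by auto
  then have n2: "n \<ge> 2" using n by linarith
  have bpow: "b [^] (n * q) \<in> B" for q
    using n B.pow_mem[of "b [^] n" q] b by (simp add: nat_pow_pow)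
  \<comment> \<open>Division with remainder: the remainder is also an exponent taking
    \<open>b\<close> into \<open>B\<close>, hence 0 by minimality of \<open>n\<close>.\<close>
  have dvd: "n dvd m" if m: "b [^] m \<in> B" for m
  proof -
    have "b [^] m = b [^] (n * (m div n)) \<otimes> b [^] (m mod n)"
      using b by (simp add: nat_pow_mult)
    then have "b [^] (m mod n) = inv (b [^] (n * (m div n))) \<otimes> b [^] m"
      using b by (simp add: m_assoc[symmetric])
    then have "b [^] (m mod n) \<in> B" using bpow m by simp
    then show ?thesis
      using least[of "m mod n"] n by (metis mod_less_divisor not_le mod_greater_zero_iff_not_dvd)
  qed
  show ?thesis
  proof (rule exI[of _ n], intro conjI allI impI)
    show "n \<ge> 2" "b [^] n \<in> B" using n n2 by simp_all
    fix c assume c: "c ^ n = \<chi> (b [^] n)"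
    define B' where "B' = {a \<otimes> b [^] i | a (i::nat). a \<in> B}"
    \<comment> \<open>Well-definedness of the extension: two expressions of one element differ by a
      power of \<open>b\<close> in \<open>B\<close>, thus by a power of \<open>b [^] n\<close>, on
      which \<open>c\<close> was chosen to agree with \<open>\<chi>\<close>. Taking
      \<open>i \<le> j\<close> keeps exponents natural.\<close>
    have key: "\<chi> a * c ^ i = \<chi> a' * c ^ j" 
      if "a \<in> B" "a' \<in> B" "a \<otimes> b [^] i = a' \<otimes> b [^] j" "i \<le> j" for a a' i and j :: nat
    proof -
      have "a \<otimes> b [^] i = (a' \<otimes> b [^] (j - i)) \<otimes> b [^] i"
        using that b by (simp add: m_assoc nat_pow_mult)
      then have a: "a = a' \<otimes> b [^] (j - i)"
        using that b by (metis mem_carrier B.mem_carrier m_closed nat_pow_closed right_cancel)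
      then have "b [^] (j - i) = inv a' \<otimes> a"
        using that b by (simp add: m_assoc[symmetric])
      then have mem: "b [^] (j - i) \<in> B" using that by simp
      then obtain q where q: "j - i = n * q" using dvd by blast
      have "\<chi> (b [^] (j - i)) = \<chi> ((b [^] n) [^] q)"
        using b q by (simp add: nat_pow_pow)
      also have "\<dots> = c ^ (j - i)"
        using n \<chi> c q by (simp add: B.dual_pow power_mult)
      finally have "\<chi> a = \<chi> a' * c ^ (j - i)"
        using a that mem \<chi> by (simp add: B.dual_mult)
      then show ?thesis
        using that by (simp add: mult.assoc power_add[symmetric])
    qed
    have wd: "\<chi> a * c ^ i = \<chi> a' * c ^ j" 
      if "a \<in> B" "a' \<in> B" "a \<otimes> b [^] i = a' \<otimes> b [^] j" for a a' i and j :: nat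
      using key[OF that] key[OF that(2,1) that(3)[symmetric]] by (metis linorder_linear)
    define \<chi>' where "\<chi>' x = (if x \<in> B' then (THE z. \<exists>a i. a \<in> B \<and> x = a \<otimes> b [^] (i::nat) \<and> z = \<chi> a * c ^ i) else 0)" for x
    have ev: "\<chi>' (a \<otimes> b [^] i) = \<chi> a * c ^ i" if "a \<in> B" for a i
    proof -
      have "a \<otimes> b [^] i \<in> B'" using that B'_def by blast
      moreover have "(THE z. \<exists>a' j. a' \<in> B \<and> a \<otimes> b [^] i = a' \<otimes> b [^] (j::nat) \<and> z = \<chi> a' * c ^ j) = \<chi> a * c ^ i"
        by (rule the_equality) (use that wd[OF that] in \<open>blast, metis\<close>)
      ultimately show ?thesis by (simp add: \<chi>'_def)
    qed
    have prod: "(a \<otimes> b [^] i) \<otimes> (a' \<otimes> b [^] j) = (a \<otimes> a') \<otimes> b [^] (i + j)" 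
      if "a \<in> B" "a' \<in> B" for a a' i and j :: nat
    proof -
      have "b [^] i \<otimes> a' = a' \<otimes> b [^] i" using that b B(2) by (intro comm) auto
      then have "(a \<otimes> b [^] i) \<otimes> (a' \<otimes> b [^] j) = a \<otimes> (a' \<otimes> b [^] i) \<otimes> b [^] j"
        using that b by (metis B.mem_carrier m_assoc m_closed mem_carrier nat_pow_closed)
      then show ?thesis using that b by (simp add: m_assoc nat_pow_mult)
    qed
    have B'A: "B' \<subseteq> A" using b B(2) by (auto simp: B'_def)
    have BB': "B \<subseteq> B'"
    proof
      fix x assume "x \<in> B"
      then have "x = x \<otimes> b [^] (0::nat)" by simp
      then show "x \<in> B'" using \<open>x \<in> B\<close> B'_def by blast
    qed
    have be: "b = \<one> \<otimes> b [^] (1::nat)" using b by simp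
    then have bB': "b \<in> B'" using B'_def B.one_mem by blast
    have mult: "x \<otimes> y \<in> B'" if "x \<in> B'" "y \<in> B'" for x y
      using that prod unfolding B'_def by (smt (verit) B.mult_mem mem_Collect_eq)
    have pw: "x [^] (i::nat) \<in> B'" if "x \<in> B'" for x i
      using that mult BB' by (induction i) auto
    have sub': "subgroup B' G"
    proof (rule subgroupI)
      show "B' \<subseteq> carrier G" using B'A by auto
      show "B' \<noteq> {}" using bB' by blast
      fix x assume x: "x \<in> B'"
      then have xA: "x \<in> A" using B'A by blast
      \<comment> \<open>In a finite group the inverse is a power, so closure under products
        suffices.\<close>
      have "x \<otimes> x [^] (card A - 1) = \<one>"
        using pow_card[OF xA] xA card_pos
        by (metis Suc_diff_1 mem_carrier nat_pow_Suc2)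
      then have "inv x = x [^] (card A - 1)"
        using xA by (metis inv_equality mem_carrier nat_pow_closed inv_comm)
      then show "inv x \<in> B'" using pw x by simp
    qed (use mult in auto)
    have "\<chi>' \<in> dual G B'"
      unfolding dual_def mem_Collect_eq
    proof (intro conjI ballI allI impI)
      show "\<chi>' x = 0" if "x \<notin> B'" for x using that by (simp add: \<chi>'_def)
      show "\<chi>' \<one> = 1" using ev[of \<one> 0] B.dual_one[OF \<chi>] by simp
      fix x y assume "x \<in> B'" "y \<in> B'"
      then obtain a i a' j where xy: "x = a \<otimes> b [^] (i::nat)" "y = a' \<otimes> b [^] (j::nat)" "a \<in> B" "a' \<in> B"
        by (auto simp: B'_def)
      then have "\<chi>' (x \<otimes> y) = \<chi> (a \<otimes> a') * c ^ (i + j)" by (simp only: prod ev B.mult_mem)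
      then show "\<chi>' (x \<otimes> y) = \<chi>' x * \<chi>' y"
        using xy \<chi> by (simp add: ev B.dual_mult power_add)
    qed
    moreover have "\<forall>x\<in>B. \<chi>' x = \<chi> x" using ev[where i=0] by simp
    moreover have "\<chi>' b = c" using ev[of \<one> 1] B.dual_one[OF \<chi>] b by simp
    ultimately show "\<exists>B' \<chi>'. subgroup B' G \<and> B' \<subseteq> A \<and> B \<subset> B' \<and> \<chi>' \<in> dual G B' \<and> (\<forall>x\<in>B. \<chi>' x = \<chi> x) \<and> \<chi>' b = c"
      using sub' B'A BB' bB' b by blast
  qed
qed

text \<open>Adjoin elements one at a time; the complement of the subgroup in \<open>A\<close>
  shrinks, and the required \<open>n\<close>-th root always exists in the complex numbers.\<close>

lemma dual_extend_full:
  assumes "subgroup B G" "B \<subseteq> A" "\<chi> \<in> dual G B"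
  shows "\<exists>\<chi>'\<in>dual G A. \<forall>x\<in>B. \<chi>' x = \<chi> x"
  using assms
proof (induction "card (A - B)" arbitrary: B \<chi> rule: less_induct)
  case less
  show ?case
  proof (cases "B = A")
    case False
    then obtain b where b: "b \<in> A" "b \<notin> B" using less.prems by blast
    from dual_extend[OF less.prems b] obtain n :: nat where n: "n \<ge> 2"
      and ext: "\<And>c. c ^ n = \<chi> (b [^] n) \<Longrightarrow> (\<exists>B' \<chi>'. subgroup B' G \<and> B' \<subseteq> A \<and> B \<subset> B' \<and> \<chi>' \<in> dual G B' \<and>
         (\<forall>x\<in>B. \<chi>' x = \<chi> x) \<and> \<chi>' b = c)"
      by blast
    obtain c where "c ^ n = \<chi> (b [^] n)"
      using n using nth_root_exists[of n] by force
    then obtain B' \<chi>' where B': "subgroup B' G" "B' \<subseteq> A" "B \<subset> B'" "\<chi>' \<in> dual G B'" "\<forall>x\<in>B. \<chi>' x = \<chi> x"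
      using ext by blast
    have "card (A - B') < card (A - B)"
      using B' fin by (intro psubset_card_mono) auto
    from less.hyps[OF this B'(1,2,4)] B' show ?thesis by (metis psubsetE subset_iff)
  qed (use less.prems in auto)
qed

text \<open>Extend the trivial character of the trivial subgroup: here \<open>n \<ge> 2\<close> and
  \<open>c\<close> may be any \<open>n\<close>-th root of unity, so it can be chosen different from
  1.\<close>

lemma dual_separates:
  assumes "x \<in> A" "x \<noteq> \<one>"
  shows "\<exists>\<chi>\<in>dual G A. \<chi> x \<noteq> 1"
proof -
  have triv: "(\<lambda>y. of_bool (y = \<one>)) \<in> dual G {\<one>}"
    by (simp add: dual_def)
  have "{\<one>} \<subseteq> A" "x \<notin> {\<one>}" using assms by auto
  from dual_extend[OF triv_subgroup this(1) triv assms(1) this(2)]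
  obtain n :: nat where n: "n \<ge> 2" "x [^] n = \<one>"
    and ext: "\<And>c. c ^ n = 1 \<Longrightarrow>
       \<exists>B' \<chi>'. subgroup B' G \<and> B' \<subseteq> A \<and> \<chi>' \<in> dual G B' \<and> \<chi>' x = c"
    by auto blast
  have "card {z::complex. z ^ n = 1} = n"
    using n by (intro card_roots_unity_eq) auto
  then have "\<not> {z::complex. z ^ n = 1} \<subseteq> {1}"
    using n card_mono[of "{1::complex}" "{z::complex. z ^ n = 1}"] by auto
  then obtain c :: complex where c: "c ^ n = 1" "c \<noteq> 1" by blast
  obtain B' \<chi>' where "subgroup B' G" "B' \<subseteq> A" "\<chi>' \<in> dual G B'" "\<chi>' x = c"
    using ext[OF c(1)] by blast
  \<comment> \<open>Otherwise \<open>\<chi>' x\<close> would be the default value 0, which is no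
    root of unity. Membership is needed for the extension to \<open>A\<close> to keep the value at
    \<open>x\<close>.\<close>
  moreover from this have "x \<in> B'" using c n by (auto simp: dual_def power_0_left)
  ultimately show ?thesis using dual_extend_full[of B' \<chi>'] c by metis
qed

text \<open>Multiplication by a character \<open>\<mu>\<close> with
  \<open>\<mu> x \<noteq> 1\<close> permutes the dual group and multiplies the sum by
  \<open>\<mu> x\<close>.\<close>

lemma sum_over_dual_nontrivial:
  assumes "x \<in> A" "x \<noteq> \<one>"
  shows "(\<Sum>\<chi>\<in>dual G A. \<chi> x) = 0"
proof -
  obtain \<mu> where \<mu>: "\<mu> \<in> dual G A" "\<mu> x \<noteq> 1" using dual_separates[OF assms] by blast
  have nz: "\<mu> y \<noteq> 0" if "y \<in> A" for y using dual_norm[OF \<mu>(1) that] by auto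
  have "(\<Sum>\<chi>\<in>dual G A. \<chi> x) = (\<Sum>\<chi>\<in>dual G A. \<mu> x * \<chi> x)"
  proof (rule sum.reindex_bij_witness[where i="\<lambda>\<nu> y. \<mu> y * \<nu> y" and j="\<lambda>\<nu> y. \<nu> y / \<mu> y"])
    fix \<nu> assume \<nu>: "\<nu> \<in> dual G A"
    \<comment> \<open>Off \<open>A\<close> all functions are 0 and division by 0 yields 0, so the
      two maps are inverse everywhere.\<close>
    show "(\<lambda>y. \<mu> y * (\<nu> y / \<mu> y)) = \<nu>" "(\<lambda>y. \<mu> y * \<nu> y / \<mu> y) = \<nu>"
      using nz dual_zero[OF \<nu>] dual_zero[OF \<mu>(1)] by (auto simp: fun_eq_iff)
    show "(\<lambda>y. \<nu> y / \<mu> y) \<in> dual G A" "(\<lambda>y. \<mu> y * \<nu> y) \<in> dual G A"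
      using \<nu> \<mu>(1) by (auto simp: dual_def)
    show "\<mu> x * (\<nu> x / \<mu> x) = \<nu> x" using nz assms(1) by simp
  qed
  also have "\<dots> = \<mu> x * (\<Sum>\<chi>\<in>dual G A. \<chi> x)"
    by (simp add: sum_distrib_left)
  finally show ?thesis using \<mu>(2) by (metis mult_cancel_right1)
qed

lemma principal_in_dual: "(\<lambda>x. of_bool (x \<in> A)) \<in> dual G A"
  by (simp add: dual_def)

text \<open>Sum \<open>\<chi> x\<close> over all characters and all elements. Row by row only the
  principal character contributes, giving \<open>card A\<close>; column by column only the identity
  does, giving the size of the dual.\<close>

lemma card_dual: "card (dual G A) = card A"
proof -
  let ?p = "\<lambda>x. of_bool (x \<in> A) :: complex"
  have "of_nat (card A) = (\<Sum>\<chi>\<in>dual G A. \<Sum>x\<in>A. \<chi> x * cnj (?p x))"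
    using row_orthogonality[OF _ principal_in_dual]
    by (subst sum.cong[OF refl, of _ _ "\<lambda>\<chi>. if \<chi> = ?p then of_nat (card A) else 0"])
       (auto simp: principal_in_dual finite_dual)
  also have "\<dots> = (\<Sum>x\<in>A. \<Sum>\<chi>\<in>dual G A. \<chi> x)"
    by (subst sum.swap) simp
  also have "\<dots> = (\<Sum>x\<in>{\<one>}. \<Sum>\<chi>\<in>dual G A. \<chi> x)"
    using fin sum_over_dual_nontrivial by (intro sum.mono_neutral_right) auto
  also have "\<dots> = of_nat (card (dual G A))"
    by (simp add: dual_one)
  finally show ?thesis using of_nat_eq_iff[where ?'a=complex] by metis
qed

lemma sum_over_dual:
  "x \<in> A \<Longrightarrow> (\<Sum>\<chi>\<in>dual G A. \<chi> x) = (if x = \<one> then of_nat (card A) else 0)"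
  using sum_over_dual_nontrivial by (simp add: dual_one card_dual)

lemma column_orthogonality:
  assumes "x \<in> A" "y \<in> A"
  shows "(\<Sum>\<chi>\<in>dual G A. \<chi> x * cnj (\<chi> y)) = (if x = y then of_nat (card A) else 0)"
proof -
  have "(\<Sum>\<chi>\<in>dual G A. \<chi> x * cnj (\<chi> y)) = (\<Sum>\<chi>\<in>dual G A. \<chi> (x \<otimes> inv y))"
    using assms by (intro sum.cong) (auto simp: dual_mult dual_cnj)
  moreover have "x \<otimes> inv y = \<one> \<longleftrightarrow> x = y"
    using assms by (metis inv_mem inv_equality inv_inv mem_carrier r_inv)
  ultimately show ?thesis using assms by (simp add: sum_over_dual)
qed

end

section \<open>Complex matrix representations\<close>

lemma subspace_module_vec_iff:
  "VectorSpace.subspace class_ring W (module_vec TYPE(complex) n) \<longleftrightarrow>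
     W \<subseteq> carrier_vec n \<and> 0\<^sub>v n \<in> W \<and> (\<forall>v\<in>W. \<forall>w\<in>W. v + w \<in> W) \<and> (\<forall>c. \<forall>v\<in>W. c \<cdot>\<^sub>v v \<in> W)"
proof -
  have vs: "vectorspace class_ring (module_vec TYPE(complex) n)"
    by (rule vec_vs)
  then have m: "Module.module class_ring (module_vec TYPE(complex) n)"
    by (simp add: vectorspace_def)
  show ?thesis
    using vs m by (auto simp: VectorSpace.subspace_def submodule_def module_vec_simps)
qed

text \<open>Invertibility of \<open>\<rho> g\<close> comes for free from the conditions on the
  right, with the image of the inverse of \<open>g\<close> as inverse matrix.\<close>

lemma hom_GL_iff:
  assumes "group G"
  shows "\<rho> \<in> hom G (GL n) \<longleftrightarrow>
    (\<forall>g\<in>carrier G. \<rho> g \<in> carrier_mat n n) \<and> \<rho> \<one>\<^bsub>G\<^esub> = 1\<^sub>m n \<and>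
    (\<forall>g\<in>carrier G. \<forall>g'\<in>carrier G. \<rho> (g \<otimes>\<^bsub>G\<^esub> g') = \<rho> g * \<rho> g')"
proof -
  interpret G: group G by fact
  let ?R = "ring_mat TYPE(complex) n ()"
  interpret R: ring ?R by (rule ring_mat)
  have GL: "group (GL n)" unfolding GL_def by (rule R.units_group)
  have mem: "A \<in> carrier (GL n) \<longleftrightarrow> A \<in> carrier_mat n n \<and> (\<exists>B\<in>carrier_mat n n. B * A = 1\<^sub>m n \<and> A * B = 1\<^sub>m n)" for A
    by (simp add: GL_def units_of_def Units_def ring_mat_simps)
  have ops: "Group.mult (GL n) = (*)" "Group.one (GL n) = 1\<^sub>m n"
    by (simp_all add: GL_def units_of_def ring_mat_simps)
  show ?thesis
  proof
    assume \<rho>: "\<rho> \<in> hom G (GL n)"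
    then interpret h: group_hom G "GL n" \<rho>
      using GL assms by (simp add: group_hom_def group_hom_axioms_def)
    show "(\<forall>g\<in>carrier G. \<rho> g \<in> carrier_mat n n) \<and> \<rho> \<one>\<^bsub>G\<^esub> = 1\<^sub>m n \<and>
      (\<forall>g\<in>carrier G. \<forall>g'\<in>carrier G. \<rho> (g \<otimes>\<^bsub>G\<^esub> g') = \<rho> g * \<rho> g')"
      using h.hom_closed h.hom_mult h.hom_one by (simp add: mem ops)
  next
    assume a: "(\<forall>g\<in>carrier G. \<rho> g \<in> carrier_mat n n) \<and> \<rho> \<one>\<^bsub>G\<^esub> = 1\<^sub>m n \<and>
      (\<forall>g\<in>carrier G. \<forall>g'\<in>carrier G. \<rho> (g \<otimes>\<^bsub>G\<^esub> g') = \<rho> g * \<rho> g')"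
    have "\<rho> g \<in> carrier (GL n)" if g: "g \<in> carrier G" for g
    proof -
      have "\<rho> (inv\<^bsub>G\<^esub> g) * \<rho> g = 1\<^sub>m n \<and> \<rho> g * \<rho> (inv\<^bsub>G\<^esub> g) = 1\<^sub>m n"
        using a g by (metis G.inv_closed G.l_inv G.r_inv)
      then show ?thesis using a g mem G.inv_closed by blast
    qed
    then show "\<rho> \<in> hom G (GL n)" using a by (auto simp: hom_def ops)
  qed
qed

section \<open>Matrix identities and finite sums of vectors\<close>

lemma mat_eq_by_action:
  fixes A B :: "'a::semiring_1 mat"
  assumes "A \<in> carrier_mat n m" "B \<in> carrier_mat n m"
    and "\<And>j. j < m \<Longrightarrow> A *\<^sub>v unit_vec m j = B *\<^sub>v unit_vec m j"
  shows "A = B"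
proof (rule eq_matI)
  fix i j assume ij: "i < dim_row B" "j < dim_col B"
  have "(M *\<^sub>v unit_vec m j) $ i = M $$ (i, j)" if "M \<in> carrier_mat n m" for M :: "'a mat"
    using that ij assms by simp
  then show "A $$ (i, j) = B $$ (i, j)" using assms ij by (metis carrier_matD(2))
qed (use assms in auto)

lemma mult_mat_unit_vec:
  fixes A :: "'a::semiring_1 mat"
  assumes "A \<in> carrier_mat n m" "j < m"
  shows "A *\<^sub>v unit_vec m j = col A j"
  using assms by (intro eq_vecI) auto

lemma mat_trace_mult_commute:
  assumes "A \<in> carrier_mat n m" "B \<in> carrier_mat m n"
  shows "mat_trace (A * B) = mat_trace (B * A)"
proof -
  have "mat_trace (A * B) = (\<Sum>i<n. \<Sum>j<m. A $$ (i, j) * B $$ (j, i))"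
    using assms by (auto simp: mat_trace_def scalar_prod_def atLeast0LessThan intro!: sum.cong)
  also have "\<dots> = (\<Sum>j<m. \<Sum>i<n. B $$ (j, i) * A $$ (i, j))"
    by (subst sum.swap) (simp add: mult.commute)
  also have "\<dots> = mat_trace (B * A)"
    using assms by (auto simp: mat_trace_def scalar_prod_def atLeast0LessThan intro!: sum.cong)
  finally show ?thesis .
qed

text \<open>The zero vector depends on the dimension, so the sum carries \<open>n\<close> and is
  formed entrywise.\<close>

definition vec_sum :: "nat \<Rightarrow> 'b set \<Rightarrow> ('b \<Rightarrow> complex vec) \<Rightarrow> complex vec" where
  "vec_sum n A f = vec n (\<lambda>i. \<Sum>x\<in>A. f x $ i)"

lemma vec_sum_carrier [simp]: "vec_sum n A f \<in> carrier_vec n"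
  by (simp add: vec_sum_def)

lemma mult_mat_vec_sum:
  assumes "M \<in> carrier_mat m n" "\<And>x. x \<in> A \<Longrightarrow> f x \<in> carrier_vec n"
  shows "M *\<^sub>v vec_sum n A f = vec_sum m A (\<lambda>x. M *\<^sub>v f x)"
proof (rule eq_vecI)
  fix i assume "i < dim_vec (vec_sum m A (\<lambda>x. M *\<^sub>v f x))"
  then have i: "i < m" by (simp add: vec_sum_def)
  have "(M *\<^sub>v vec_sum n A f) $ i = (\<Sum>j<n. \<Sum>x\<in>A. M $$ (i, j) * f x $ j)"
    using assms i by (simp add: vec_sum_def scalar_prod_def atLeast0LessThan sum_distrib_left)
  also have "\<dots> = (\<Sum>x\<in>A. \<Sum>j<n. M $$ (i, j) * f x $ j)"
    by (rule sum.swap)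
  also have "\<dots> = (\<Sum>x\<in>A. (M *\<^sub>v f x) $ i)"
  proof (rule sum.cong[OF refl])
    fix x assume "x \<in> A"
    then have "dim_vec (f x) = n" using assms(2) by fastforce
    then show "(\<Sum>j<n. M $$ (i, j) * f x $ j) = (M *\<^sub>v f x) $ i"
      using assms(1) i by (simp add: scalar_prod_def atLeast0LessThan)
  qed
  finally show "(M *\<^sub>v vec_sum n A f) $ i = vec_sum m A (\<lambda>x. M *\<^sub>v f x) $ i"
    using i by (simp add: vec_sum_def)
qed (use assms in \<open>simp add: vec_sum_def\<close>)

lemma smult_vec_sum:
  assumes "\<And>x. x \<in> A \<Longrightarrow> f x \<in> carrier_vec n"
  shows "c \<cdot>\<^sub>v vec_sum n A f = vec_sum n A (\<lambda>x. c \<cdot>\<^sub>v f x)"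
proof (rule eq_vecI)
  fix i assume "i < dim_vec (vec_sum n A (\<lambda>x. c \<cdot>\<^sub>v f x))"
  then have i: "i < n" by (simp add: vec_sum_def)
  then have "(c \<cdot>\<^sub>v f x) $ i = c * f x $ i" if "x \<in> A" for x
    using assms[OF that] by auto
  then show "(c \<cdot>\<^sub>v vec_sum n A f) $ i = vec_sum n A (\<lambda>x. c \<cdot>\<^sub>v f x) $ i"
    using i by (simp add: vec_sum_def sum_distrib_left)
qed (simp add: vec_sum_def)

lemma vec_sum_cong:
  "(\<And>x. x \<in> A \<Longrightarrow> f x = g x) \<Longrightarrow> vec_sum n A f = vec_sum n A g"
  by (simp add: vec_sum_def)

lemma vec_sum_in_subspace:
  assumes W: "VectorSpace.subspace class_ring W (module_vec TYPE(complex) n)"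
    and "finite A" "\<And>x. x \<in> A \<Longrightarrow> f x \<in> W"
  shows "vec_sum n A f \<in> W"
  using assms(2,3)
proof (induction A rule: finite_induct)
  case empty
  have "vec_sum n {} f = 0\<^sub>v n" by (simp add: vec_sum_def zero_vec_def)
  then show ?case using W by (simp add: subspace_module_vec_iff)
next
  case (insert x A)
  then have f: "f x \<in> W" "f x \<in> carrier_vec n" "vec_sum n A f \<in> W"
    using W by (auto simp: subspace_module_vec_iff)
  have "vec_sum n (insert x A) f = f x + vec_sum n A f"
    using f insert by (intro eq_vecI) (auto simp: vec_sum_def)
  then show ?case using W f by (simp add: subspace_module_vec_iff)
qed

locale matrix_rep = group G for G (structure) +
  fixes n :: nat and \<rho> :: "'a \<Rightarrow> complex mat"
  assumes hom: "\<rho> \<in> hom G (GL n)"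
begin

lemma rep_carrier [simp]: "g \<in> carrier G \<Longrightarrow> \<rho> g \<in> carrier_mat n n"
  using hom hom_GL_iff[OF is_group] by metis

lemma rep_one [simp]: "\<rho> \<one> = 1\<^sub>m n"
  using hom hom_GL_iff[OF is_group] by metis

lemma rep_mult: "g \<in> carrier G \<Longrightarrow> g' \<in> carrier G \<Longrightarrow> \<rho> (g \<otimes> g') = \<rho> g * \<rho> g'"
  using hom hom_GL_iff[OF is_group] by metis

lemma rep_action_mult:
  "g \<in> carrier G \<Longrightarrow> g' \<in> carrier G \<Longrightarrow> v \<in> carrier_vec n \<Longrightarrow> \<rho> (g \<otimes> g') *\<^sub>v v = \<rho> g *\<^sub>v (\<rho> g' *\<^sub>v v)"
  using assoc_mult_mat_vec[of "\<rho> g" n n "\<rho> g'" n v] by (simp add: rep_mult)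

lemma rep_action_carrier [simp]: "g \<in> carrier G \<Longrightarrow> v \<in> carrier_vec n \<Longrightarrow> \<rho> g *\<^sub>v v \<in> carrier_vec n"
  using mult_mat_vec_carrier rep_carrier by blast

lemma rep_action_zero [simp]: "g \<in> carrier G \<Longrightarrow> \<rho> g *\<^sub>v 0\<^sub>v n = 0\<^sub>v n"
  by (intro eq_vecI) (auto simp: carrier_matD[OF rep_carrier])

lemma rep_action_nonzero:
  assumes "g \<in> carrier G" "v \<in> carrier_vec n" "v \<noteq> 0\<^sub>v n"
  shows "\<rho> g *\<^sub>v v \<noteq> 0\<^sub>v n"
proof
  assume "\<rho> g *\<^sub>v v = 0\<^sub>v n"
  then have "\<rho> (inv g) *\<^sub>v (\<rho> g *\<^sub>v v) = 0\<^sub>v n"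
    using assms by auto
  then show False using assms rep_action_mult[of "inv g" g v] by simp
qed

text \<open>For a character \<open>\<chi>\<close> of an abelian subgroup \<open>A\<close> this is
  \<open>card A\<close> times the projection onto the \<open>\<chi>\<close>-eigenspace. The scalar
  is harmless, since only being a nonzero eigenvector matters.\<close>

definition isotypic_part :: "'a set \<Rightarrow> ('a \<Rightarrow> complex) \<Rightarrow> complex vec \<Rightarrow> complex vec" where
  "isotypic_part A \<chi> v = vec_sum n A (\<lambda>x. cnj (\<chi> x) \<cdot>\<^sub>v (\<rho> x *\<^sub>v v))"

lemma isotypic_part_carrier [simp]: "isotypic_part A \<chi> v \<in> carrier_vec n"
  by (simp add: isotypic_part_def)

lemma isotypic_part_eigen:
  assumes A: "finite_abelian_subgroup G A" and \<chi>: "\<chi> \<in> dual G A" and v: "v \<in> carrier_vec n"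
    and y: "y \<in> A"
  shows "\<rho> y *\<^sub>v isotypic_part A \<chi> v = \<chi> y \<cdot>\<^sub>v isotypic_part A \<chi> v"
proof -
  interpret A: finite_abelian_subgroup G A by fact
  have "\<rho> y *\<^sub>v isotypic_part A \<chi> v = vec_sum n A (\<lambda>x. \<rho> y *\<^sub>v (cnj (\<chi> x) \<cdot>\<^sub>v (\<rho> x *\<^sub>v v)))"
    unfolding isotypic_part_def using y v by (intro mult_mat_vec_sum) auto
  also have "\<dots> = vec_sum n A (\<lambda>x. cnj (\<chi> x) \<cdot>\<^sub>v (\<rho> (y \<otimes> x) *\<^sub>v v))"
    using y v by (intro vec_sum_cong) (auto simp: rep_action_mult mult_mat_vec[of _ n n])
  \<comment> \<open>Inserting \<open>\<chi> y * cnj (\<chi> y) = 1\<close> makes the summand a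
    function of \<open>y \<otimes> x\<close>, ready for translation by \<open>y\<close>.\<close>
  also have "\<dots> = vec_sum n A (\<lambda>x. \<chi> y \<cdot>\<^sub>v (cnj (\<chi> (y \<otimes> x)) \<cdot>\<^sub>v (\<rho> (y \<otimes> x) *\<^sub>v v)))"
  proof (rule vec_sum_cong)
    fix x assume x: "x \<in> A"
    have "\<chi> y * cnj (\<chi> y) = 1"
      using A.dual_norm[OF \<chi> y] by (simp add: complex_norm_square[symmetric])
    then show "cnj (\<chi> x) \<cdot>\<^sub>v (\<rho> (y \<otimes> x) *\<^sub>v v) = \<chi> y \<cdot>\<^sub>v (cnj (\<chi> (y \<otimes> x)) \<cdot>\<^sub>v (\<rho> (y \<otimes> x) *\<^sub>v v))"
      using x y \<chi> by (simp add: A.dual_mult smult_smult_assoc mult.assoc[symmetric])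
  qed
  also have "\<dots> = vec_sum n A (\<lambda>x. \<chi> y \<cdot>\<^sub>v (cnj (\<chi> x) \<cdot>\<^sub>v (\<rho> x *\<^sub>v v)))"
    unfolding vec_sum_def
    by (subst A.sum_translate[OF y, of "\<lambda>x. (\<chi> y \<cdot>\<^sub>v (cnj (\<chi> x) \<cdot>\<^sub>v (\<rho> x *\<^sub>v v))) $ _"]) simp
  also have "\<dots> = \<chi> y \<cdot>\<^sub>v isotypic_part A \<chi> v"
    unfolding isotypic_part_def using v by (intro smult_vec_sum[symmetric]) auto
  finally show ?thesis .
qed

text \<open>By column orthogonality at the identity the isotypic parts of \<open>v\<close> add up to
  \<open>card A\<close> times \<open>v\<close>, so they cannot all vanish.\<close>

lemma exists_isotypic_part:
  assumes A: "finite_abelian_subgroup G A" and v: "v \<in> carrier_vec n" "v \<noteq> 0\<^sub>v n"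
  shows "\<exists>\<chi>\<in>dual G A. isotypic_part A \<chi> v \<noteq> 0\<^sub>v n"
proof (rule ccontr)
  interpret A: finite_abelian_subgroup G A by fact
  assume "\<not> ?thesis"
  then have z: "isotypic_part A \<chi> v = 0\<^sub>v n" if "\<chi> \<in> dual G A" for \<chi> using that by blast
  have "v = 0\<^sub>v n"
  proof (rule eq_vecI)
    fix i assume "i < dim_vec (0\<^sub>v n :: complex vec)"
    then have i: "i < n" by simp
    have "0 = (\<Sum>\<chi>\<in>dual G A. isotypic_part A \<chi> v $ i)"
      using z i by simp
    \<comment> \<open>The factor \<open>\<chi> \<one> = 1\<close> brings the inner sum into the form
      of column orthogonality.\<close>
    also have "\<dots> = (\<Sum>\<chi>\<in>dual G A. \<Sum>x\<in>A. \<chi> \<one> * cnj (\<chi> x) * (\<rho> x *\<^sub>v v) $ i)"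
    proof (intro sum.cong refl)
      fix \<chi> assume "\<chi> \<in> dual G A"
      have "(c \<cdot>\<^sub>v (\<rho> x *\<^sub>v v)) $ i = c * (\<rho> x *\<^sub>v v) $ i" if "x \<in> A" for x c
        using carrier_vecD[OF rep_action_carrier[OF A.mem_carrier[OF that] v(1)]] i by simp
      then show "isotypic_part A \<chi> v $ i = (\<Sum>x\<in>A. \<chi> \<one> * cnj (\<chi> x) * (\<rho> x *\<^sub>v v) $ i)"
        unfolding isotypic_part_def vec_sum_def using i \<open>\<chi> \<in> dual G A\<close>
        by (simp add: A.dual_one)
    qed
    also have "\<dots> = (\<Sum>x\<in>A. (\<Sum>\<chi>\<in>dual G A. \<chi> \<one> * cnj (\<chi> x)) * (\<rho> x *\<^sub>v v) $ i)"
      by (subst sum.swap) (simp add: sum_distrib_right)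
    also have "\<dots> = (\<Sum>x\<in>A. if x = \<one> then of_nat (card A) * (\<rho> x *\<^sub>v v) $ i else 0)"
      by (intro sum.cong) (auto simp: A.column_orthogonality)
    also have "\<dots> = of_nat (card A) * v $ i"
      using A.fin v(1) by simp
    finally show "v $ i = 0\<^sub>v n $ i" using A.card_pos i by simp
  qed (use v in simp)
  then show False using v by simp
qed

end

section \<open>Schur's lemma and comparison of traces\<close>

lemma irreducible_rep_matrix_rep:
  "group G \<Longrightarrow> irreducible_rep G n \<rho> \<Longrightarrow> matrix_rep G n \<rho>"
  by (simp add: irreducible_rep_def matrix_rep_def matrix_rep_axioms_def)

lemma irreducible_rep_subspaceD:
  "irreducible_rep G n \<rho> \<Longrightarrow> VectorSpace.subspace class_ring W (module_vec TYPE(complex) n) \<Longrightarrow>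
   (\<And>g w. g \<in> carrier G \<Longrightarrow> w \<in> W \<Longrightarrow> \<rho> g *\<^sub>v w \<in> W) \<Longrightarrow> W = {0\<^sub>v n} \<or> W = carrier_vec n"
  by (simp add: irreducible_rep_def)

text \<open>Schur's lemma: the range of \<open>P\<close> is everything and its kernel is trivial, so \<open>P\<close> is
  invertible.\<close>

lemma irreducible_intertwiner_trace:
  assumes G: "group G" and \<rho>: "irreducible_rep G n \<rho>" and \<sigma>: "irreducible_rep G m \<sigma>"
    and P: "P \<in> carrier_mat n m" "P \<noteq> 0\<^sub>m n m"
    and eq: "\<And>g. g \<in> carrier G \<Longrightarrow> \<rho> g * P = P * \<sigma> g"
    and g: "g \<in> carrier G"
  shows "mat_trace (\<rho> g) = mat_trace (\<sigma> g)"
proof -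
  interpret \<rho>: matrix_rep G n \<rho> using G \<rho> by (rule irreducible_rep_matrix_rep)
  interpret \<sigma>: matrix_rep G m \<sigma> using G \<sigma> by (rule irreducible_rep_matrix_rep)
  have act: "\<rho> g *\<^sub>v (P *\<^sub>v c) = P *\<^sub>v (\<sigma> g *\<^sub>v c)" if "g \<in> carrier G" "c \<in> carrier_vec m" for g c
    using that P eq[of g] by (metis \<rho>.rep_carrier \<sigma>.rep_carrier assoc_mult_mat_vec)
  have "\<exists>j<m. P *\<^sub>v unit_vec m j \<noteq> 0\<^sub>v n"
  proof (rule ccontr)
    assume "\<not> ?thesis"
    then have "P = 0\<^sub>m n m"
      using P(1) by (intro mat_eq_by_action[of _ n m]) auto
    then show False using P by simp
  qed
  then obtain j where j: "j < m" "P *\<^sub>v unit_vec m j \<noteq> 0\<^sub>v n" by blast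
  let ?R = "(\<lambda>c. P *\<^sub>v c) ` carrier_vec m"
  have "?R = {0\<^sub>v n} \<or> ?R = carrier_vec n"
  proof (rule irreducible_rep_subspaceD[OF \<rho>])
    show "VectorSpace.subspace class_ring ?R (module_vec TYPE(complex) n)"
      unfolding subspace_module_vec_iff
    proof (intro conjI ballI allI)
      show "?R \<subseteq> carrier_vec n" using P(1) by auto
      show "0\<^sub>v n \<in> ?R" using P(1) by (intro image_eqI[of _ _ "0\<^sub>v m"]) auto
      fix v assume "v \<in> ?R"
      then obtain a where a: "a \<in> carrier_vec m" "v = P *\<^sub>v a" by blast
      show "c \<cdot>\<^sub>v v \<in> ?R" for c
        using a P(1) by (intro image_eqI[of _ _ "c \<cdot>\<^sub>v a"]) (auto simp: mult_mat_vec)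
      fix w assume "w \<in> ?R"
      then obtain b where b: "b \<in> carrier_vec m" "w = P *\<^sub>v b" by blast
      show "v + w \<in> ?R"
        using a b P(1) by (intro image_eqI[of _ _ "a + b"]) (auto simp: mult_add_distrib_mat_vec)
    qed
    fix g w assume "g \<in> carrier G" "w \<in> ?R"
    then show "\<rho> g *\<^sub>v w \<in> ?R" using act \<sigma>.rep_action_carrier by auto
  qed
  moreover have "?R \<noteq> {0\<^sub>v n}" using j unit_vec_carrier by blast
  ultimately have R: "?R = carrier_vec n" by blast
  let ?N = "{c \<in> carrier_vec m. P *\<^sub>v c = 0\<^sub>v n}"
  have "?N = {0\<^sub>v m} \<or> ?N = carrier_vec m"
  proof (rule irreducible_rep_subspaceD[OF \<sigma>])
    show "VectorSpace.subspace class_ring ?N (module_vec TYPE(complex) m)"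
      unfolding subspace_module_vec_iff
      using P(1) by (auto simp: mult_mat_vec mult_add_distrib_mat_vec)
    fix g w assume g: "g \<in> carrier G" and "w \<in> ?N"
    then have w: "w \<in> carrier_vec m" "P *\<^sub>v w = 0\<^sub>v n" by auto
    have "P *\<^sub>v (\<sigma> g *\<^sub>v w) = 0\<^sub>v n"
      unfolding act[OF g w(1), symmetric] w(2) using g by simp
    then show "\<sigma> g *\<^sub>v w \<in> ?N" using g w(1) by simp
  qed
  moreover have "?N \<noteq> carrier_vec m" using j unit_vec_carrier by blast
  ultimately have N: "?N = {0\<^sub>v m}" by blast
  have "\<exists>c\<in>carrier_vec m. P *\<^sub>v c = unit_vec n i" for i
    using R unit_vec_carrier[of n i] by (metis imageE)
  then obtain c where c: "\<And>i. c i \<in> carrier_vec m" "\<And>i. P *\<^sub>v c i = unit_vec n i" by metis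
  \<comment> \<open>The columns are preimages of the unit vectors under \<open>P\<close>, which
    makes \<open>Q\<close> a right inverse.\<close>
  define Q where "Q = mat_of_cols m (map c [0..<n])"
  have Q: "Q \<in> carrier_mat m n" by (simp add: Q_def mat_of_cols_def)
  have Qu: "Q *\<^sub>v unit_vec n i = c i" if "i < n" for i
  proof -
    have "Q *\<^sub>v unit_vec n i = col Q i" using Q that by (simp add: mult_mat_unit_vec)
    then show ?thesis using that c(1) by (simp add: Q_def)
  qed
  have PQ: "P * Q = 1\<^sub>m n"
    using P(1) Q c by (intro mat_eq_by_action[of _ n n]) (auto simp: assoc_mult_mat_vec[of _ n m _ n] Qu)
  \<comment> \<open>Equality of \<open>n\<close> and \<open>m\<close> is not known at this point, so
    the left inverse law is derived from the trivial kernel: \<open>P\<close> sends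
    \<open>Q * P *\<^sub>v ?u - ?u\<close> to 0.\<close>
  have QP: "Q * P = 1\<^sub>m m"
  proof (rule mat_eq_by_action[of _ m m])
    fix j assume "j < m"
    let ?u = "unit_vec m j :: complex vec"
    have QPu: "Q * P *\<^sub>v ?u \<in> carrier_vec m"
      using P(1) Q by (intro mult_mat_vec_carrier[of _ m m]) auto
    have "P *\<^sub>v (Q * P *\<^sub>v ?u) = P * (Q * P) *\<^sub>v ?u"
      using P(1) Q by (intro assoc_mult_mat_vec[symmetric, of _ n m _ m]) auto
    also have "P * (Q * P) = P * Q * P"
      using P(1) Q by (intro assoc_mult_mat[symmetric])
    also have "\<dots> = P" using P(1) PQ by simp
    finally have "P *\<^sub>v (Q * P *\<^sub>v ?u - ?u) = P *\<^sub>v ?u - P *\<^sub>v ?u"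
      using P(1) QPu by (simp add: mult_minus_distrib_mat_vec)
    also have "\<dots> = 0\<^sub>v n" using P(1) by (intro eq_vecI) auto
    finally have "Q * P *\<^sub>v ?u - ?u \<in> ?N" using QPu by simp
    then have z: "Q * P *\<^sub>v ?u - ?u = 0\<^sub>v m" using N by blast
    show "Q * P *\<^sub>v ?u = 1\<^sub>m m *\<^sub>v ?u"
    proof (rule eq_vecI)
      fix i assume "i < dim_vec (1\<^sub>m m *\<^sub>v ?u)"
      then have i: "i < m" by simp
      have "(Q * P *\<^sub>v ?u) $ i - ?u $ i = (Q * P *\<^sub>v ?u - ?u) $ i"
        using i by (intro index_minus_vec(1)[symmetric]) simp
      also have "\<dots> = 0" using z i by simp
      finally show "(Q * P *\<^sub>v ?u) $ i = (1\<^sub>m m *\<^sub>v ?u) $ i" by simp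
    qed (use Q in simp)
  qed (use P(1) Q in auto)
  have "mat_trace (\<rho> g) = mat_trace (\<rho> g * (P * Q))"
    using right_mult_one_mat[OF \<rho>.rep_carrier[OF g]] PQ by simp
  also have "\<rho> g * (P * Q) = \<rho> g * P * Q"
    using g P(1) Q by (intro assoc_mult_mat[of _ n n _ m _ n, symmetric]) auto
  also have "\<dots> = P * (\<sigma> g * Q)"
    unfolding eq[OF g] using g P(1) Q by (intro assoc_mult_mat[of _ n m _ m _ n]) auto
  also have "mat_trace \<dots> = mat_trace (\<sigma> g * Q * P)"
    using P(1) mult_carrier_mat[OF \<sigma>.rep_carrier[OF g] Q] by (rule mat_trace_mult_commute)
  also have "\<sigma> g * Q * P = \<sigma> g * (Q * P)"
    using g P(1) Q by (intro assoc_mult_mat[of _ m m _ n _ m]) auto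
  also have "\<dots> = \<sigma> g" using right_mult_one_mat[OF \<sigma>.rep_carrier[OF g]] QP by simp
  finally show ?thesis .
qed

lemma mat_of_cols_mult_vec:
  assumes "\<And>j. j < m \<Longrightarrow> v j \<in> carrier_vec n" "c \<in> carrier_vec m"
  shows "mat_of_cols n (map v [0..<m]) *\<^sub>v c = vec_sum n {..<m} (\<lambda>j. c $ j \<cdot>\<^sub>v v j)"
proof (rule eq_vecI)
  fix i assume "i < dim_vec (vec_sum n {..<m} (\<lambda>j. c $ j \<cdot>\<^sub>v v j))"
  then have i: "i < n" by (simp add: vec_sum_def)
  have "(c $ j \<cdot>\<^sub>v v j) $ i = c $ j * v j $ i" if "j < m" for j
    using carrier_vecD[OF assms(1)[OF that]] i by simp
  then show "(mat_of_cols n (map v [0..<m]) *\<^sub>v c) $ i = vec_sum n {..<m} (\<lambda>j. c $ j \<cdot>\<^sub>v v j) $ i"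
    using i assms(2) by (simp add: vec_sum_def scalar_prod_def mat_of_cols_index atLeast0LessThan mult.commute)
qed (simp add: vec_sum_def)

text \<open>Vectors that transform like the standard basis under \<open>\<sigma>\<close> are the
  columns of an intertwiner. One of them being nonzero is enough, as Schur's lemma then makes them a
  basis.\<close>

lemma irreducible_trace_eq:
  assumes G: "group G" and \<rho>: "irreducible_rep G n \<rho>" and \<sigma>: "irreducible_rep G m \<sigma>"
    and v: "\<And>j. j < m \<Longrightarrow> v j \<in> carrier_vec n" "j < m" "v j \<noteq> 0\<^sub>v n"
    and eq: "\<And>g j. g \<in> carrier G \<Longrightarrow> j < m \<Longrightarrow>
      \<rho> g *\<^sub>v v j = vec_sum n {..<m} (\<lambda>i. \<sigma> g $$ (i, j) \<cdot>\<^sub>v v i)"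
    and g: "g \<in> carrier G"
  shows "mat_trace (\<rho> g) = mat_trace (\<sigma> g)"
proof (rule irreducible_intertwiner_trace[OF G \<rho> \<sigma>])
  interpret \<rho>: matrix_rep G n \<rho> using G \<rho> by (rule irreducible_rep_matrix_rep)
  interpret \<sigma>: matrix_rep G m \<sigma> using G \<sigma> by (rule irreducible_rep_matrix_rep)
  let ?P = "mat_of_cols n (map v [0..<m])"
  show P: "?P \<in> carrier_mat n m" by (simp add: mat_of_cols_def)
  have Pu: "?P *\<^sub>v unit_vec m j = v j" if "j < m" for j
    using that v(1) P by (simp add: mult_mat_unit_vec)
  show "?P \<noteq> 0\<^sub>m n m"
  proof
    assume "?P = 0\<^sub>m n m"
    then have "v j = 0\<^sub>m n m *\<^sub>v unit_vec m j" using Pu[OF v(2)] by simp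
    also have "\<dots> = 0\<^sub>v n" using v(2) by (intro eq_vecI) auto
    finally show False using v(3) by simp
  qed
  show "\<rho> g * ?P = ?P * \<sigma> g" if g: "g \<in> carrier G" for g
  proof (rule mat_eq_by_action)
    show "\<rho> g * ?P \<in> carrier_mat n m"
      using g P by (intro mult_carrier_mat[of _ n n]) auto
    show "?P * \<sigma> g \<in> carrier_mat n m"
      using g P by (intro mult_carrier_mat[of _ n m]) auto
    fix j assume j: "j < m"
    have s: "\<sigma> g *\<^sub>v unit_vec m j = col (\<sigma> g) j"
      using g j by (intro mult_mat_unit_vec[of _ m]) auto
    have c: "col (\<sigma> g) j $ i = \<sigma> g $$ (i, j)" if "i < m" for i
      using g j that carrier_matD[OF \<sigma>.rep_carrier[OF g]] by simp
    have "\<rho> g * ?P *\<^sub>v unit_vec m j = \<rho> g *\<^sub>v v j"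
      using g P j by (simp add: assoc_mult_mat_vec[of _ n n _ m] Pu)
    also have "\<dots> = ?P *\<^sub>v col (\<sigma> g) j"
      using g j carrier_matD[OF \<sigma>.rep_carrier[OF g]] v(1)
      by (subst mat_of_cols_mult_vec) (auto simp: eq c intro!: vec_sum_cong)
    also have "\<dots> = ?P * \<sigma> g *\<^sub>v unit_vec m j"
      using g P by (simp add: assoc_mult_mat_vec[of _ n m _ m] s)
    finally show "\<rho> g * ?P *\<^sub>v unit_vec m j = ?P * \<sigma> g *\<^sub>v unit_vec m j" .
  qed
qed (rule g)

section \<open>Class functions and the passage from classes to elements\<close>

lemma Irr_class_function:
  assumes "group G" "\<chi> \<in> Irr G" "g \<in> carrier G" "x \<in> carrier G"
  shows "\<chi> (g \<otimes>\<^bsub>G\<^esub> x \<otimes>\<^bsub>G\<^esub> inv\<^bsub>G\<^esub> g) = \<chi> x"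
proof -
  obtain n \<rho> where \<rho>: "irreducible_rep G n \<rho>" "\<chi> = character_of G \<rho>"
    using assms(2) by (auto simp: Irr_def)
  interpret \<rho>: matrix_rep G n \<rho> using assms(1) \<rho>(1) by (rule irreducible_rep_matrix_rep)
  let ?i = "inv\<^bsub>G\<^esub> g"
  have "mat_trace (\<rho> (g \<otimes>\<^bsub>G\<^esub> x \<otimes>\<^bsub>G\<^esub> ?i)) = mat_trace (\<rho> (g \<otimes>\<^bsub>G\<^esub> x) * \<rho> ?i)"
    using assms by (simp add: \<rho>.rep_mult)
  also have "\<dots> = mat_trace (\<rho> ?i * \<rho> (g \<otimes>\<^bsub>G\<^esub> x))"
    using assms by (intro mat_trace_mult_commute[of _ n n]) auto
  also have "\<rho> ?i * \<rho> (g \<otimes>\<^bsub>G\<^esub> x) = \<rho> (?i \<otimes>\<^bsub>G\<^esub> (g \<otimes>\<^bsub>G\<^esub> x))"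
    using assms by (simp add: \<rho>.rep_mult)
  also have "?i \<otimes>\<^bsub>G\<^esub> (g \<otimes>\<^bsub>G\<^esub> x) = x"
    using assms by (simp add: \<rho>.m_assoc[symmetric])
  finally show ?thesis using assms \<rho> by (simp add: character_of_def)
qed

lemma AM_Z_sum_over_group:
  assumes "group G" and fin: "finite (carrier G)"
  shows "AM_Z G = 1 / real (Coset.order G) ^ 2 * (\<Sum>g\<in>carrier G. \<Sum>g'\<in>carrier G.
     cmod (\<Sum>\<chi>\<in>Irr G. char_degree G \<chi> ^ 2 * \<chi> g * cnj (\<chi> g')))"
proof -
  interpret group G by fact
  let ?\<phi> = "\<lambda>g. \<lambda>x\<in>carrier G. g \<otimes>\<^bsub>G\<^esub> x \<otimes>\<^bsub>G\<^esub> inv\<^bsub>G\<^esub> g"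
  interpret act: group_action G "carrier G" ?\<phi> by (rule action_by_conjugation)
  have sub: "C \<subseteq> carrier G" if "C \<in> Conj G" for C
    using that act.orbits_coverture by (auto simp: Conj_def)
  have val: "value_on \<chi> C = \<chi> g" if C: "C \<in> Conj G" and g: "g \<in> C" and \<chi>: "\<chi> \<in> Irr G" for \<chi> C g
  proof -
    obtain x where x: "x \<in> carrier G" "C = orbit G ?\<phi> x"
      using C by (auto simp: Conj_def orbits_def)
    have "\<chi> y = \<chi> x" if "y \<in> C" for y
      using that x Irr_class_function[OF assms(1) \<chi>] by (auto simp: orbit_def)
    \<comment> \<open>\<open>value_on\<close> takes \<open>the_elem\<close> of this image, so its
      value is known only once the image is a singleton.\<close>
    then have "\<chi> ` C = {\<chi> g}" using g by auto
    then show ?thesis by (simp add: value_on_def)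
  qed
  have ds: "(\<Sum>C\<in>Conj G. \<Sum>x\<in>C. f x) = (\<Sum>x\<in>carrier G. f x)" for f :: "'a \<Rightarrow> real"
    unfolding Conj_def by (rule act.disjoint_sum[OF fin])
  let ?F = "\<lambda>g g'. cmod (\<Sum>\<chi>\<in>Irr G. char_degree G \<chi> ^ 2 * \<chi> g * cnj (\<chi> g'))"
  have "(\<Sum>C\<in>Conj G. \<Sum>D\<in>Conj G.
        cmod (\<Sum>\<chi>\<in>Irr G. char_degree G \<chi> ^ 2 * value_on \<chi> C * cnj (value_on \<chi> D))
        * real (card C) * real (card D)) = (\<Sum>C\<in>Conj G. \<Sum>D\<in>Conj G. \<Sum>g\<in>C. \<Sum>g'\<in>D. ?F g g')"
  proof (intro sum.cong refl)
    fix C D assume C: "C \<in> Conj G" and D: "D \<in> Conj G"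
    have "(\<Sum>g\<in>C. \<Sum>g'\<in>D. ?F g g') = (\<Sum>g\<in>C. \<Sum>g'\<in>D.
        cmod (\<Sum>\<chi>\<in>Irr G. char_degree G \<chi> ^ 2 * value_on \<chi> C * cnj (value_on \<chi> D)))"
      using val[OF C] val[OF D] by (intro sum.cong refl arg_cong[of _ _ cmod]) simp
    then show "cmod (\<Sum>\<chi>\<in>Irr G. char_degree G \<chi> ^ 2 * value_on \<chi> C * cnj (value_on \<chi> D))
        * real (card C) * real (card D) = (\<Sum>g\<in>C. \<Sum>g'\<in>D. ?F g g')" by simp
  qed
  also have "\<dots> = (\<Sum>C\<in>Conj G. \<Sum>g\<in>C. \<Sum>D\<in>Conj G. \<Sum>g'\<in>D. ?F g g')"
    by (intro sum.cong[OF refl] sum.swap)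
  also have "\<dots> = (\<Sum>g\<in>carrier G. \<Sum>g'\<in>carrier G. ?F g g')"
    unfolding ds ..
  finally show ?thesis by (simp add: AM_Z_def)
qed

section \<open>Semidirect products with a fixed-point-free action\<close>

lemma (in group) mult_inv_eq_one:
  assumes "x \<in> carrier G" "y \<in> carrier G" "x \<otimes> inv y = \<one>"
  shows "x = y"
proof -
  have "x = x \<otimes> inv y \<otimes> y" using assms(1,2) by (simp add: m_assoc)
  then show ?thesis using assms by simp
qed

lemma (in group) inv_mult_eq_one:
  assumes "x \<in> carrier G" "y \<in> carrier G" "inv x \<otimes> y = \<one>"
  shows "x = y"
proof -
  have "y = x \<otimes> (inv x \<otimes> y)" using assms(1,2) by (simp add: mult_inv_cancel_left)
  then show ?thesis using assms by simp
qed

text \<open>The properties of kernel and complement on which the character theory rests, separated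
  from malnormality. The decomposition says that H represents the left cosets of K uniquely.\<close>

locale frobenius_pair = group G for G (structure) +
  fixes K H
  assumes finite_carrier: "finite (carrier G)"
    and kernel: "finite_abelian_subgroup G K"
    and complement: "finite_abelian_subgroup G H"
    and kernel_conj: "\<And>x g. x \<in> K \<Longrightarrow> g \<in> carrier G \<Longrightarrow> inv g \<otimes> x \<otimes> g \<in> K"
    and decomposition: "\<And>g. g \<in> carrier G \<Longrightarrow> \<exists>!t. t \<in> H \<and> inv t \<otimes> g \<in> K"
    and fixed_point_free: "\<And>x y. x \<in> K \<Longrightarrow> y \<in> H \<Longrightarrow> x \<otimes> y = y \<otimes> x \<Longrightarrow> x = \<one> \<or> y = \<one>"
    and kernel_nontrivial: "K \<noteq> {\<one>}"
    and complement_nontrivial: "H \<noteq> {\<one>}"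

sublocale frobenius_pair \<subseteq> K: finite_abelian_subgroup G K by (rule kernel)
sublocale frobenius_pair \<subseteq> H: finite_abelian_subgroup G H by (rule complement)

context frobenius_pair
begin

text \<open>The quotient map from G to G/K, with G/K identified with H.\<close>

definition pr :: "'a \<Rightarrow> 'a" where
  "pr g = (THE t. t \<in> H \<and> inv t \<otimes> g \<in> K)"

lemma pr_mem: "g \<in> carrier G \<Longrightarrow> pr g \<in> H"
  and pr_quotient: "g \<in> carrier G \<Longrightarrow> inv (pr g) \<otimes> g \<in> K"
  using theI'[OF decomposition, of g] by (simp_all add: pr_def)

lemma pr_eqI: "g \<in> carrier G \<Longrightarrow> t \<in> H \<Longrightarrow> inv t \<otimes> g \<in> K \<Longrightarrow> pr g = t"
  using decomposition[of g] pr_mem[of g] pr_quotient[of g] by blast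

lemma pr_complement [simp]: "t \<in> H \<Longrightarrow> pr t = t"
  by (rule pr_eqI) auto

lemma pr_kernel: "g \<in> carrier G \<Longrightarrow> g \<in> K \<longleftrightarrow> pr g = \<one>"
  using pr_eqI[of g \<one>] pr_quotient[of g] by auto

lemma pr_of_kernel: "x \<in> K \<Longrightarrow> pr x = \<one>"
  using pr_kernel[of x] by simp

lemma pr_mult:
  assumes "g \<in> carrier G" "g' \<in> carrier G"
  shows "pr (g \<otimes> g') = pr g \<otimes> pr g'"
proof (rule pr_eqI)
  let ?t = "pr g" and ?t' = "pr g'"
  have t: "?t \<in> carrier G" "?t' \<in> carrier G" using assms pr_mem by auto
  \<comment> \<open>Both factors lie in K: the first is a conjugate of the kernel part of
    \<open>g\<close>, the second is the kernel part of \<open>g'\<close>.\<close>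
  have "inv (?t \<otimes> ?t') \<otimes> (g \<otimes> g') = (inv ?t' \<otimes> (inv ?t \<otimes> g) \<otimes> ?t') \<otimes> (inv ?t' \<otimes> g')"
    using assms t by (simp add: inv_mult_group m_assoc mult_inv_cancel_left inv_mult_cancel_left)
  then show "inv (?t \<otimes> ?t') \<otimes> (g \<otimes> g') \<in> K"
    using assms t by (simp add: kernel_conj pr_quotient)
qed (use assms pr_mem in auto)

lemma kernel_conj_iff:
  assumes "g \<in> carrier G" "x \<in> carrier G"
  shows "inv g \<otimes> x \<otimes> g \<in> K \<longleftrightarrow> x \<in> K"
proof
  assume "inv g \<otimes> x \<otimes> g \<in> K"
  then have "inv (inv g) \<otimes> (inv g \<otimes> x \<otimes> g) \<otimes> inv g \<in> K"
    using assms kernel_conj by blast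
  then show "x \<in> K" using assms by (simp add: m_assoc)
       (simp add: m_assoc[symmetric])
qed (use assms kernel_conj in auto)

lemma kernel_mult_left_iff:
  assumes "x \<in> K" "g \<in> carrier G"
  shows "g \<otimes> x \<in> K \<longleftrightarrow> g \<in> K"
proof -
  have "pr (g \<otimes> x) = pr g"
    using assms pr_mem[of g] by (simp add: pr_mult pr_of_kernel)
  then show ?thesis
    using assms pr_kernel[of g] pr_kernel[of "g \<otimes> x"] by simp
qed

lemma sum_carrier: "(\<Sum>g\<in>carrier G. f g) = (\<Sum>t\<in>H. \<Sum>x\<in>K. f (t \<otimes> x))"
proof -
  have "pr (t \<otimes> x) = t" if "t \<in> H" "x \<in> K" for t x
    using that by (simp add: pr_mult pr_of_kernel)
  then have "(\<Sum>g\<in>carrier G. f g) = (\<Sum>(t,x)\<in>H \<times> K. f (t \<otimes> x))"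
    by (intro sum.reindex_bij_witness[where i="\<lambda>(t,x). t \<otimes> x" and j="\<lambda>g. (pr g, inv (pr g) \<otimes> g)"])
       (auto simp: pr_mem pr_quotient mult_inv_cancel_left inv_mult_cancel_left)
  then show ?thesis by (simp add: sum.cartesian_product)
qed

lemma order_eq: "Coset.order G = card H * card K"
  using sum_carrier[of "\<lambda>_. 1::nat"] by (simp add: Coset.order_def)

lemma card_complement_ge_2: "card H \<ge> 2"
proof -
  obtain y where "y \<in> H" "y \<noteq> \<one>" using complement_nontrivial H.one_mem by blast
  then have "card {y, \<one>} \<le> card H" using H.fin H.one_mem by (intro card_mono) auto
  then show ?thesis using \<open>y \<noteq> \<one>\<close> by simp
qed

subsection \<open>Characters of the kernel\<close>

definition nonprincipal :: "('a \<Rightarrow> complex) set" where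
  "nonprincipal = dual G K - {\<lambda>x. of_bool (x \<in> K)}"

text \<open>The conjugation action on characters of K. The explicit 0 keeps the function extensional
  also outside the carrier, where conjugation is unspecified.\<close>

definition twist :: "'a \<Rightarrow> ('a \<Rightarrow> complex) \<Rightarrow> 'a \<Rightarrow> complex" where
  "twist y \<chi> = (\<lambda>x. if x \<in> K then \<chi> (inv y \<otimes> x \<otimes> y) else 0)"

lemma twist_one: "\<chi> \<in> dual G K \<Longrightarrow> twist \<one> \<chi> = \<chi>"
  by (auto simp: twist_def fun_eq_iff K.dual_zero)

lemma twist_in_dual:
  assumes "\<chi> \<in> dual G K" "y \<in> carrier G"
  shows "twist y \<chi> \<in> dual G K"
proof -
  have "\<chi> (inv y \<otimes> (a \<otimes> b) \<otimes> y) = \<chi> (inv y \<otimes> a \<otimes> y) * \<chi> (inv y \<otimes> b \<otimes> y)" if "a \<in> K" "b \<in> K" for a b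
  proof -
    have "inv y \<otimes> (a \<otimes> b) \<otimes> y = (inv y \<otimes> a \<otimes> y) \<otimes> (inv y \<otimes> b \<otimes> y)"
      using that assms(2) by (simp add: m_assoc mult_inv_cancel_left inv_mult_cancel_left)
    then show ?thesis using that assms by (simp add: K.dual_mult kernel_conj)
  qed
  then show ?thesis
    using assms by (auto simp: dual_def twist_def)
qed

text \<open>Conjugation by \<open>u \<noteq> 1\<close> fixes no nontrivial element of the kernel, so
  \<open>x \<mapsto> x\<^sup>-\<^sup>1 u\<^sup>-\<^sup>1 x u\<close> is injective on the kernel, hence surjective.\<close>

lemma twist_fixed:
  assumes \<chi>: "\<chi> \<in> nonprincipal" and u: "u \<in> H" and eq: "\<And>x. x \<in> K \<Longrightarrow> \<chi> (inv u \<otimes> x \<otimes> u) = \<chi> x"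
  shows "u = \<one>"
proof (rule ccontr)
  assume ne: "u \<noteq> \<one>"
  let ?\<phi> = "\<lambda>x. inv x \<otimes> (inv u \<otimes> x \<otimes> u)"
  have d: "\<chi> \<in> dual G K" using \<chi> by (simp add: nonprincipal_def)
  have "inj_on ?\<phi> K"
  proof (rule inj_onI)
    fix x y assume x: "x \<in> K" and y: "y \<in> K" and e: "?\<phi> x = ?\<phi> y"
    let ?x = "inv u \<otimes> x \<otimes> u" and ?y = "inv u \<otimes> y \<otimes> u"
    have m: "?x \<in> K" "?y \<in> K" using x y u by (simp_all add: kernel_conj)
    \<comment> \<open>Since K is abelian, \<open>?\<phi> x = ?\<phi> y\<close> can be rearranged to
      say that conjugation by \<open>u\<close> fixes \<open>x \<otimes> inv y\<close>, which is then
      trivial.\<close>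
    have "?x = x \<otimes> (inv y \<otimes> ?y)" using e x m by (metis K.inv_mem K.mem_carrier inv_solve_left K.mult_mem y)
    also have "\<dots> = ?y \<otimes> (x \<otimes> inv y)"
      using x y m by (metis K.comm K.inv_mem K.mem_carrier K.mult_mem m_assoc)
    finally have 1: "inv ?y \<otimes> ?x = x \<otimes> inv y"
      using x y m by (simp add: inv_solve_left')
    have "inv ?y \<otimes> ?x = ?x \<otimes> inv ?y" using m by (intro K.comm) auto
    also have "\<dots> = inv u \<otimes> (x \<otimes> inv y) \<otimes> u"
      using x y u by (simp add: inv_mult_group m_assoc mult_inv_cancel_left inv_mult_cancel_left)
    finally have "x \<otimes> inv y = inv u \<otimes> (x \<otimes> inv y) \<otimes> u" using 1 by simp
    then have "u \<otimes> (x \<otimes> inv y) = u \<otimes> (inv u \<otimes> (x \<otimes> inv y) \<otimes> u)"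
      by (rule arg_cong)
    also have "\<dots> = (x \<otimes> inv y) \<otimes> u"
      using x y u by (simp add: m_assoc mult_inv_cancel_left inv_mult_cancel_left)
    finally have "u \<otimes> (x \<otimes> inv y) = (x \<otimes> inv y) \<otimes> u" .
    then have "x \<otimes> inv y = \<one>"
      using fixed_point_free[of "x \<otimes> inv y" u] x y u ne by auto
    then show "x = y" using x y mult_inv_eq_one[of x y] by simp
  qed
  moreover have "?\<phi> ` K \<subseteq> K" using u by (auto simp: kernel_conj)
  ultimately have surj: "?\<phi> ` K = K" by (intro endo_inj_surj K.fin)
  have "\<chi> z = 1" if "z \<in> K" for z
  proof -
    have "z \<in> ?\<phi> ` K" unfolding surj by (rule that)
    then obtain x where x: "x \<in> K" "z = ?\<phi> x" by (rule imageE)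
    \<comment> \<open>A character invariant under \<open>u\<close> is 1 on every value of
      \<open>?\<phi>\<close>, hence on all of K.\<close>
    have "\<chi> z = \<chi> (inv x) * \<chi> (inv u \<otimes> x \<otimes> u)"
      using x u d by (simp add: K.dual_mult kernel_conj)
    also have "\<dots> = \<chi> (inv x \<otimes> x)"
      using x d eq by (simp add: K.dual_mult[symmetric])
    finally show ?thesis using x d by (simp add: K.dual_one)
  qed
  then have "\<chi> = (\<lambda>x. of_bool (x \<in> K))"
    using d by (auto simp: fun_eq_iff K.dual_zero)
  then show False using \<chi> by (simp add: nonprincipal_def)
qed

text \<open>If two twists agree, then \<open>inv z \<otimes> y\<close> stabilises
  \<open>\<chi>\<close>; evaluating them at \<open>z \<otimes> x \<otimes> inv z\<close> shows
  this.\<close>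

lemma twist_inj:
  assumes \<chi>: "\<chi> \<in> nonprincipal" and y: "y \<in> H" "z \<in> H" and eq: "twist y \<chi> = twist z \<chi>"
  shows "y = z"
proof -
  have "inv z \<otimes> y = \<one>"
  proof (rule twist_fixed[OF \<chi>])
    fix x assume x: "x \<in> K"
    have c: "z \<otimes> x \<otimes> inv z \<in> K" using kernel_conj[OF x, of "inv z"] y by simp
    then have "\<chi> (inv y \<otimes> (z \<otimes> x \<otimes> inv z) \<otimes> y) = \<chi> (inv z \<otimes> (z \<otimes> x \<otimes> inv z) \<otimes> z)"
      using fun_cong[OF eq, of "z \<otimes> x \<otimes> inv z"] by (simp add: twist_def)
    moreover have "inv z \<otimes> (z \<otimes> x \<otimes> inv z) \<otimes> z = x"
      using x y by (simp add: m_assoc) (simp add: m_assoc[symmetric])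
    moreover have "inv y \<otimes> (z \<otimes> x \<otimes> inv z) \<otimes> y = inv (inv z \<otimes> y) \<otimes> x \<otimes> (inv z \<otimes> y)"
      using x y by (simp add: inv_mult_group m_assoc)
    ultimately show "\<chi> (inv (inv z \<otimes> y) \<otimes> x \<otimes> (inv z \<otimes> y)) = \<chi> x" by simp
  qed (use y in auto)
  then show ?thesis using y inv_mult_eq_one[of z y] by auto
qed

lemma nonprincipal_dual: "\<chi> \<in> nonprincipal \<Longrightarrow> \<chi> \<in> dual G K"
  by (simp add: nonprincipal_def)

lemma twist_nonprincipal:
  assumes \<chi>: "\<chi> \<in> nonprincipal" and y: "y \<in> carrier G"
  shows "twist y \<chi> \<in> nonprincipal"
proof -
  have d: "\<chi> \<in> dual G K" using \<chi> by (rule nonprincipal_dual)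
  have "twist y \<chi> \<noteq> (\<lambda>x. of_bool (x \<in> K))"
  proof
    assume e: "twist y \<chi> = (\<lambda>x. of_bool (x \<in> K))"
    have "\<chi> x = 1" if "x \<in> K" for x
    proof -
      have c: "y \<otimes> x \<otimes> inv y \<in> K" using kernel_conj[OF that, of "inv y"] y by simp
      have "inv y \<otimes> (y \<otimes> x \<otimes> inv y) \<otimes> y = x"
        using that y by (simp add: m_assoc) (simp add: m_assoc[symmetric])
      then show ?thesis using fun_cong[OF e, of "y \<otimes> x \<otimes> inv y"] c by (simp add: twist_def)
    qed
    then have "\<chi> = (\<lambda>x. of_bool (x \<in> K))"
      using d by (auto simp: fun_eq_iff K.dual_zero)
    then show False using \<chi> by (simp add: nonprincipal_def)
  qed
  then show ?thesis using twist_in_dual[OF d y] by (simp add: nonprincipal_def)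
qed

subsection \<open>Lifted and induced representations\<close>

definition lifted_rep :: "('a \<Rightarrow> complex) \<Rightarrow> 'a \<Rightarrow> complex mat" where
  "lifted_rep \<mu> g = mat 1 1 (\<lambda>_. \<mu> (pr g))"

definition lifted_char :: "('a \<Rightarrow> complex) \<Rightarrow> 'a \<Rightarrow> complex" where
  "lifted_char \<mu> = (\<lambda>g\<in>carrier G. \<mu> (pr g))"

lemma lifted_rep_irreducible:
  assumes \<mu>: "\<mu> \<in> dual G H"
  shows "irreducible_rep G 1 (lifted_rep \<mu>)"
proof -
  have "lifted_rep \<mu> \<in> hom G (GL 1)"
    unfolding hom_GL_iff[OF is_group]
    using \<mu> by (auto simp: lifted_rep_def pr_mult pr_mem H.dual_mult H.dual_one scalar_prod_def intro!: eq_matI)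
  moreover have "W = carrier_vec 1"
    if W: "VectorSpace.subspace class_ring W (module_vec TYPE(complex) 1)" "W \<noteq> {0\<^sub>v 1}" for W
  proof -
    have W': "W \<subseteq> carrier_vec 1" "0\<^sub>v 1 \<in> W" "\<And>c v. v \<in> W \<Longrightarrow> c \<cdot>\<^sub>v v \<in> W"
      using W(1) unfolding subspace_module_vec_iff by blast+
    then obtain w where w: "w \<in> W" "w \<noteq> 0\<^sub>v 1" using W(2) by blast
    then have wc: "dim_vec w = 1" using W' by auto
    have w0: "w $ 0 \<noteq> 0"
    proof
      assume "w $ 0 = 0"
      then have "w = 0\<^sub>v 1" using wc by (intro eq_vecI) auto
      then show False using w by simp
    qed
    have "v \<in> W" if "v \<in> carrier_vec 1" for v
    proof -
      have "v = (v $ 0 / w $ 0) \<cdot>\<^sub>v w" using that wc w0 by (intro eq_vecI) auto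
      then show ?thesis using W'(3)[OF w(1)] by metis
    qed
    then show ?thesis using W'(1) by blast
  qed
  ultimately show ?thesis by (auto simp: irreducible_rep_def)
qed

lemma character_of_lifted_rep: "character_of G (lifted_rep \<mu>) = lifted_char \<mu>"
  by (simp add: character_of_def lifted_char_def lifted_rep_def mat_trace_def)

definition transversal :: "nat \<Rightarrow> 'a" where
  "transversal = (SOME b. bij_betw b {..<card H} H)"

lemma bij_transversal: "bij_betw transversal {..<card H} H"
proof -
  have "\<exists>b. bij_betw b {..<card H} H"
    using ex_bij_betw_nat_finite[OF H.fin] by (simp add: atLeast0LessThan)
  then show ?thesis unfolding transversal_def by (rule someI_ex)
qed

lemma transversal_mem [simp]: "i < card H \<Longrightarrow> transversal i \<in> H"
  using bij_betwE[OF bij_transversal] by auto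

lemma transversal_eq_iff: "i < card H \<Longrightarrow> j < card H \<Longrightarrow> transversal i = transversal j \<longleftrightarrow> i = j"
  using bij_betw_imp_inj_on[OF bij_transversal] by (auto simp: inj_on_def)

text \<open>The usual matrix of the representation induced from K, with H as coset representatives;
  entries of the wrong coset vanish because \<open>\<chi>\<close> is 0 off K.\<close>

definition induced_rep :: "('a \<Rightarrow> complex) \<Rightarrow> 'a \<Rightarrow> complex mat" where
  "induced_rep \<chi> g = mat (card H) (card H) (\<lambda>(i, j). \<chi> (inv (transversal i) \<otimes> g \<otimes> transversal j))"

definition induced_char :: "('a \<Rightarrow> complex) \<Rightarrow> 'a \<Rightarrow> complex" where
  "induced_char \<chi> = (\<lambda>g\<in>carrier G. \<Sum>y\<in>H. \<chi> (inv y \<otimes> g \<otimes> y))"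

lemma induced_rep_carrier [simp]: "induced_rep \<chi> g \<in> carrier_mat (card H) (card H)"
  by (simp add: induced_rep_def)

lemma character_of_induced_rep: "character_of G (induced_rep \<chi>) = induced_char \<chi>"
  by (simp add: character_of_def induced_char_def induced_rep_def mat_trace_def
      sum.reindex_bij_betw[OF bij_transversal, of "\<lambda>y. \<chi> (inv y \<otimes> _ \<otimes> y)"])

lemma dual_off_coset:
  assumes "\<chi> \<in> dual G K" "g \<in> carrier G" "t \<in> H" "pr g \<noteq> t"
  shows "\<chi> (inv t \<otimes> g) = 0"
  using assms pr_eqI[of g t] K.dual_zero by blast

text \<open>Only \<open>t = pr (g' \<otimes> z)\<close> contributes, because \<open>\<chi>\<close>
  vanishes off K; for this \<open>t\<close> multiplicativity of \<open>\<chi>\<close> gives the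
  product.\<close>

lemma induced_rep_mult_aux:
  assumes \<chi>: "\<chi> \<in> dual G K" and g: "g \<in> carrier G" "g' \<in> carrier G" and y: "y \<in> H" "z \<in> H"
  shows "(\<Sum>t\<in>H. \<chi> (inv y \<otimes> g \<otimes> t) * \<chi> (inv t \<otimes> g' \<otimes> z)) = \<chi> (inv y \<otimes> (g \<otimes> g') \<otimes> z)"
proof -
  let ?t = "pr (g' \<otimes> z)"
  have t: "?t \<in> H" using g y by (simp add: pr_mem)
  have x: "inv ?t \<otimes> g' \<otimes> z \<in> K" using g y t pr_quotient[of "g' \<otimes> z"] by (simp add: m_assoc)
  have zero: "\<chi> (inv s \<otimes> g' \<otimes> z) = 0" if "s \<in> H" "s \<noteq> ?t" for s
    using dual_off_coset[OF \<chi>, of "g' \<otimes> z" s] that g y by (simp add: m_assoc)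
  have "(\<Sum>s\<in>H. \<chi> (inv y \<otimes> g \<otimes> s) * \<chi> (inv s \<otimes> g' \<otimes> z))
      = (\<Sum>s\<in>{?t}. \<chi> (inv y \<otimes> g \<otimes> s) * \<chi> (inv s \<otimes> g' \<otimes> z))"
    using t H.fin zero by (intro sum.mono_neutral_right) auto
  also have "\<dots> = \<chi> (inv y \<otimes> g \<otimes> ?t) * \<chi> (inv ?t \<otimes> g' \<otimes> z)" by simp
  also have "\<dots> = \<chi> ((inv y \<otimes> g \<otimes> ?t) \<otimes> (inv ?t \<otimes> g' \<otimes> z))"
  \<comment> \<open>The second factor is in K, so if the first is not, neither is the product and
    both sides are 0.\<close>
  proof (cases "inv y \<otimes> g \<otimes> ?t \<in> K")
    case False
    then have "(inv y \<otimes> g \<otimes> ?t) \<otimes> (inv ?t \<otimes> g' \<otimes> z) \<notin> K"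
      using kernel_mult_left_iff[OF x, of "inv y \<otimes> g \<otimes> ?t"] g y t by simp
    then show ?thesis using False K.dual_zero[OF \<chi>] by simp
  qed (use x \<chi> in \<open>simp add: K.dual_mult\<close>)
  also have "(inv y \<otimes> g \<otimes> ?t) \<otimes> (inv ?t \<otimes> g' \<otimes> z) = inv y \<otimes> (g \<otimes> g') \<otimes> z"
    using g y t by (simp add: m_assoc mult_inv_cancel_left inv_mult_cancel_left)
  finally show ?thesis .
qed

lemma induced_rep_hom:
  assumes \<chi>: "\<chi> \<in> dual G K"
  shows "induced_rep \<chi> \<in> hom G (GL (card H))"
  unfolding hom_GL_iff[OF is_group]
proof (intro conjI ballI)
  show "induced_rep \<chi> \<one> = 1\<^sub>m (card H)"
  proof (rule eq_matI)
    fix i j assume "i < dim_row (1\<^sub>m (card H) :: complex mat)" "j < dim_col (1\<^sub>m (card H) :: complex mat)"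
    then have ij: "i < card H" "j < card H" by auto
    then have "\<chi> (inv (transversal i) \<otimes> transversal j) = of_bool (i = j)"
      using dual_off_coset[OF \<chi>, of "transversal j" "transversal i"] K.dual_one[OF \<chi>]
      by (auto simp: transversal_eq_iff)
    then show "induced_rep \<chi> \<one> $$ (i, j) = 1\<^sub>m (card H) $$ (i, j)"
      using ij by (simp add: induced_rep_def)
  qed (auto simp: induced_rep_def)
  fix g g' assume g: "g \<in> carrier G" "g' \<in> carrier G"
  show "induced_rep \<chi> (g \<otimes> g') = induced_rep \<chi> g * induced_rep \<chi> g'"
  proof (rule eq_matI)
    fix i j assume "i < dim_row (induced_rep \<chi> g * induced_rep \<chi> g')"
      "j < dim_col (induced_rep \<chi> g * induced_rep \<chi> g')"
    then have ij: "i < card H" "j < card H" by (auto simp: induced_rep_def)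
    then have "(induced_rep \<chi> g * induced_rep \<chi> g') $$ (i, j) =
       (\<Sum>l<card H. \<chi> (inv (transversal i) \<otimes> g \<otimes> transversal l) * \<chi> (inv (transversal l) \<otimes> g' \<otimes> transversal j))"
      by (simp add: induced_rep_def scalar_prod_def atLeast0LessThan)
    also have "\<dots> = (\<Sum>t\<in>H. \<chi> (inv (transversal i) \<otimes> g \<otimes> t) * \<chi> (inv t \<otimes> g' \<otimes> transversal j))"
      by (rule sum.reindex_bij_betw[OF bij_transversal])
    finally show "induced_rep \<chi> (g \<otimes> g') $$ (i, j) = (induced_rep \<chi> g * induced_rep \<chi> g') $$ (i, j)"
      using ij g \<chi> by (simp add: induced_rep_mult_aux) (simp add: induced_rep_def)
  qed (auto simp: induced_rep_def)
qed simp

text \<open>K is normal, so it acts diagonally, through the twists of \<open>\<chi>\<close>.\<close>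

lemma induced_rep_diagonal:
  assumes \<chi>: "\<chi> \<in> dual G K" and x: "x \<in> K" and w: "w \<in> carrier_vec (card H)" and i: "i < card H"
  shows "(induced_rep \<chi> x *\<^sub>v w) $ i = twist (transversal i) \<chi> x * w $ i"
proof -
  have "\<chi> (inv (transversal i) \<otimes> x \<otimes> transversal j) = 0" if "j < card H" "j \<noteq> i" for j
  proof -
    have "pr (x \<otimes> transversal j) = transversal j"
      using x that by (simp add: pr_mult pr_of_kernel)
    then show ?thesis
      using dual_off_coset[OF \<chi>, of "x \<otimes> transversal j" "transversal i"] x that i
      by (simp add: m_assoc transversal_eq_iff)
  qed
  then have "(\<Sum>j<card H. \<chi> (inv (transversal i) \<otimes> x \<otimes> transversal j) * w $ j)
      = (\<Sum>j\<in>{i}. \<chi> (inv (transversal i) \<otimes> x \<otimes> transversal j) * w $ j)"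
    using i by (intro sum.mono_neutral_right) auto
  then show ?thesis
    using x w i by (simp add: induced_rep_def scalar_prod_def atLeast0LessThan twist_def)
qed

lemma induced_rep_unit_vec:
  assumes \<chi>: "\<chi> \<in> dual G K" and ij: "i < card H" "j < card H"
  shows "induced_rep \<chi> (transversal i \<otimes> inv (transversal j)) *\<^sub>v unit_vec (card H) j = unit_vec (card H) i"
proof (rule eq_vecI)
  fix l assume "l < dim_vec (unit_vec (card H) i :: complex vec)"
  then have l: "l < card H" by simp
  have "\<chi> (inv (transversal l) \<otimes> transversal i) = of_bool (l = i)"
    using dual_off_coset[OF \<chi>, of "transversal i" "transversal l"] K.dual_one[OF \<chi>] l ij
    by (auto simp: transversal_eq_iff)
  moreover have "inv (transversal l) \<otimes> (transversal i \<otimes> inv (transversal j)) \<otimes> transversal j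
      = inv (transversal l) \<otimes> transversal i"
    using ij l by (simp add: m_assoc)
  ultimately show "(induced_rep \<chi> (transversal i \<otimes> inv (transversal j)) *\<^sub>v unit_vec (card H) j) $ l
      = unit_vec (card H) i $ l"
    using l ij by (subst mult_mat_unit_vec[of _ "card H" "card H"]) (auto simp: induced_rep_def)
qed (simp add: induced_rep_def)

text \<open>The twists of \<open>\<chi>\<close> by H are pairwise distinct. Averaging a vector with
  nonzero coordinate \<open>j\<close> over K therefore isolates a multiple of the unit vector
  \<open>j\<close>, and H carries that vector to all the others.\<close>

lemma induced_rep_irreducible:
  assumes \<chi>: "\<chi> \<in> nonprincipal"
  shows "irreducible_rep G (card H) (induced_rep \<chi>)"
proof -
  let ?h = "card H"
  have d: "\<chi> \<in> dual G K" using \<chi> by (rule nonprincipal_dual)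
  have "W = carrier_vec ?h"
    if W: "VectorSpace.subspace class_ring W (module_vec TYPE(complex) ?h)" "W \<noteq> {0\<^sub>v ?h}"
      and inv: "\<And>g w. g \<in> carrier G \<Longrightarrow> w \<in> W \<Longrightarrow> induced_rep \<chi> g *\<^sub>v w \<in> W" for W
  proof -
    have W': "W \<subseteq> carrier_vec ?h" "0\<^sub>v ?h \<in> W" "\<And>c v. v \<in> W \<Longrightarrow> c \<cdot>\<^sub>v v \<in> W"
      using W(1) unfolding subspace_module_vec_iff by blast+
    then obtain w where w: "w \<in> W" "w \<noteq> 0\<^sub>v ?h" using W(2) by blast
    then have wc: "w \<in> carrier_vec ?h" using W' by auto
    then obtain j where j: "j < ?h" "w $ j \<noteq> 0"
      using w(2) by (metis eq_vecI carrier_vecD dim_vec index_zero_vec)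
    let ?tw = "\<lambda>i. twist (transversal i) \<chi>"
    let ?S = "vec_sum ?h K (\<lambda>x. cnj (?tw j x) \<cdot>\<^sub>v (induced_rep \<chi> x *\<^sub>v w))"
    have S: "?S \<in> W"
      using K.fin inv w W' by (intro vec_sum_in_subspace[OF W(1)]) auto
    have "?S = (of_nat (card K) * w $ j) \<cdot>\<^sub>v unit_vec ?h j"
    proof (rule eq_vecI)
      fix i assume "i < dim_vec ((of_nat (card K) * w $ j) \<cdot>\<^sub>v unit_vec ?h j :: complex vec)"
      then have i: "i < ?h" by simp
      have "(cnj (?tw j x) \<cdot>\<^sub>v (induced_rep \<chi> x *\<^sub>v w)) $ i = ?tw i x * cnj (?tw j x) * w $ i" if "x \<in> K" for x
      proof -
        have "(cnj (?tw j x) \<cdot>\<^sub>v (induced_rep \<chi> x *\<^sub>v w)) $ i = cnj (?tw j x) * (induced_rep \<chi> x *\<^sub>v w) $ i"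
          using i by (intro index_smult_vec) (simp add: induced_rep_def)
        then show ?thesis using induced_rep_diagonal[OF d that wc i] by simp
      qed
      then have "?S $ i = (\<Sum>x\<in>K. ?tw i x * cnj (?tw j x)) * w $ i"
        using i by (simp add: vec_sum_def sum_distrib_right)
      also have "(\<Sum>x\<in>K. ?tw i x * cnj (?tw j x)) = (if i = j then of_nat (card K) else 0)"
        using twist_inj[OF \<chi>, of "transversal i" "transversal j"] i j d
        by (subst K.row_orthogonality) (auto simp: twist_in_dual transversal_eq_iff)
      finally show "?S $ i = ((of_nat (card K) * w $ j) \<cdot>\<^sub>v unit_vec ?h j) $ i"
        using i j by simp
    qed (simp add: vec_sum_def)
    then have "(1 / (of_nat (card K) * w $ j)) \<cdot>\<^sub>v ((of_nat (card K) * w $ j) \<cdot>\<^sub>v unit_vec ?h j) \<in> W"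
      using W'(3)[OF S] by metis
    moreover have "of_nat (card K) * w $ j \<noteq> 0" using j K.card_pos by simp
    ultimately have ej: "unit_vec ?h j \<in> W"
      by (simp add: smult_smult_assoc del: K.card_pos)
    have ei: "unit_vec ?h i \<in> W" if "i < ?h" for i
      using inv[OF _ ej, of "transversal i \<otimes> inv (transversal j)"] induced_rep_unit_vec[OF d that j(1)] that j
      by simp
    have "v \<in> W" if v: "v \<in> carrier_vec ?h" for v
    proof -
      have "vec_sum ?h {..<?h} (\<lambda>i. v $ i \<cdot>\<^sub>v unit_vec ?h i) \<in> W"
        using ei W' by (intro vec_sum_in_subspace[OF W(1)]) auto
      also have "vec_sum ?h {..<?h} (\<lambda>i. v $ i \<cdot>\<^sub>v unit_vec ?h i) = v"
        using v by (intro eq_vecI) (auto simp: vec_sum_def if_distrib cong: if_cong)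
      finally show ?thesis .
    qed
    then show ?thesis using W'(1) by blast
  qed
  then show ?thesis
    using induced_rep_hom[OF d] H.card_pos unfolding irreducible_rep_def by blast
qed

subsection \<open>Classification of the irreducible characters\<close>

text \<open>Averaging over H against a suitable \<open>\<mu>\<close> keeps the vector fixed by K, as
  K is normal, and makes it an eigenvector of H; it then transforms under G by \<open>\<mu>\<close>
  composed with \<open>pr\<close>.\<close>

lemma fixed_vector_lifted:
  assumes \<rho>: "irreducible_rep G n \<rho>" and e: "e \<in> carrier_vec n" "e \<noteq> 0\<^sub>v n"
    and fix_e: "\<And>x. x \<in> K \<Longrightarrow> \<rho> x *\<^sub>v e = e"
  shows "\<exists>\<mu>\<in>dual G H. character_of G \<rho> = lifted_char \<mu>"
proof -
  interpret \<rho>: matrix_rep G n \<rho> using is_group \<rho> by (rule irreducible_rep_matrix_rep)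
  obtain \<mu> where \<mu>: "\<mu> \<in> dual G H" "\<rho>.isotypic_part H \<mu> e \<noteq> 0\<^sub>v n"
    using \<rho>.exists_isotypic_part[OF complement e] by blast
  let ?e = "\<rho>.isotypic_part H \<mu> e"
  have fix': "\<rho> x *\<^sub>v ?e = ?e" if x: "x \<in> K" for x
  proof -
    have "\<rho> x *\<^sub>v ?e = vec_sum n H (\<lambda>y. \<rho> x *\<^sub>v (cnj (\<mu> y) \<cdot>\<^sub>v (\<rho> y *\<^sub>v e)))"
      unfolding \<rho>.isotypic_part_def using x e by (intro mult_mat_vec_sum) auto
    also have "\<dots> = ?e"
      unfolding \<rho>.isotypic_part_def
    proof (rule vec_sum_cong)
      fix y assume y: "y \<in> H"
      have "\<rho> x *\<^sub>v (\<rho> y *\<^sub>v e) = \<rho> (x \<otimes> y) *\<^sub>v e"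
        using x y e by (simp add: \<rho>.rep_action_mult)
      also have "x \<otimes> y = y \<otimes> (inv y \<otimes> x \<otimes> y)"
        using x y by (simp add: m_assoc[symmetric])
      also have "\<rho> \<dots> *\<^sub>v e = \<rho> y *\<^sub>v e"
        using x y e kernel_conj[OF x, of y] by (simp only: \<rho>.rep_action_mult K.mem_carrier H.mem_carrier fix_e)
      finally show "\<rho> x *\<^sub>v (cnj (\<mu> y) \<cdot>\<^sub>v (\<rho> y *\<^sub>v e)) = cnj (\<mu> y) \<cdot>\<^sub>v (\<rho> y *\<^sub>v e)"
        using x y e by (simp add: mult_mat_vec[of _ n n])
    qed
    finally show ?thesis .
  qed
  have "mat_trace (\<rho> g) = mat_trace (lifted_rep \<mu> g)" if "g \<in> carrier G" for g
  proof (rule irreducible_trace_eq[OF is_group \<rho> lifted_rep_irreducible[OF \<mu>(1)], of "\<lambda>_. ?e" 0])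
    fix g and j :: nat assume g: "g \<in> carrier G" and j: "j < 1"
    have t: "pr g \<in> H" using g by (rule pr_mem)
    have "g = pr g \<otimes> (inv (pr g) \<otimes> g)" using g t by (simp add: m_assoc[symmetric])
    then have "\<rho> g *\<^sub>v ?e = \<rho> (pr g) *\<^sub>v (\<rho> (inv (pr g) \<otimes> g) *\<^sub>v ?e)"
      using g t by (metis \<rho>.rep_action_mult H.mem_carrier K.mem_carrier pr_quotient \<rho>.isotypic_part_carrier)
    also have "\<dots> = \<mu> (pr g) \<cdot>\<^sub>v ?e"
      using g t e fix'[OF pr_quotient[OF g]] \<rho>.isotypic_part_eigen[OF complement \<mu>(1) e(1) t] by simp
    also have "\<dots> = vec_sum n {..<1} (\<lambda>i. lifted_rep \<mu> g $$ (i, j) \<cdot>\<^sub>v ?e)"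
      using j carrier_vecD[OF \<rho>.isotypic_part_carrier]
      by (intro eq_vecI) (auto simp: vec_sum_def lifted_rep_def)
    finally show "\<rho> g *\<^sub>v ?e = vec_sum n {..<1} (\<lambda>i. lifted_rep \<mu> g $$ (i, j) \<cdot>\<^sub>v ?e)" .
  qed (use \<mu> that in auto)
  then have "character_of G \<rho> = character_of G (lifted_rep \<mu>)"
    by (auto simp: character_of_def)
  then show ?thesis using \<mu> character_of_lifted_rep by metis
qed

text \<open>The translates of \<open>e\<close> by the elements of H transform like the standard
  basis of the induced representation.\<close>

lemma eigenvector_induced:
  assumes \<rho>: "irreducible_rep G n \<rho>" and e: "e \<in> carrier_vec n" "e \<noteq> 0\<^sub>v n"
    and \<chi>: "\<chi> \<in> nonprincipal" and eig: "\<And>x. x \<in> K \<Longrightarrow> \<rho> x *\<^sub>v e = \<chi> x \<cdot>\<^sub>v e"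
  shows "character_of G \<rho> = induced_char \<chi>"
proof -
  interpret \<rho>: matrix_rep G n \<rho> using is_group \<rho> by (rule irreducible_rep_matrix_rep)
  have d: "\<chi> \<in> dual G K" using \<chi> by (rule nonprincipal_dual)
  let ?v = "\<lambda>j. \<rho> (transversal j) *\<^sub>v e"
  have "mat_trace (\<rho> g) = mat_trace (induced_rep \<chi> g)" if "g \<in> carrier G" for g
  proof (rule irreducible_trace_eq[OF is_group \<rho> induced_rep_irreducible[OF \<chi>], of ?v 0])
    show "?v j \<in> carrier_vec n" if "j < card H" for j using that e by simp
    show "?v 0 \<noteq> 0\<^sub>v n" using e by (intro \<rho>.rep_action_nonzero) auto
    fix g j assume g: "g \<in> carrier G" and j: "j < card H"
    let ?b = "transversal j" and ?t = "pr (g \<otimes> transversal j)"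
    have b: "?b \<in> H" using j by simp
    have t: "?t \<in> H" using g b by (simp add: pr_mem)
    let ?x = "inv ?t \<otimes> (g \<otimes> ?b)"
    have x: "?x \<in> K" using g b by (simp add: pr_quotient)
    have zero: "\<chi> (inv s \<otimes> g \<otimes> ?b) = 0" if "s \<in> H" "s \<noteq> ?t" for s
      using dual_off_coset[OF d, of "g \<otimes> ?b" s] that g b by (simp add: m_assoc)
    have "\<rho> g *\<^sub>v ?v j = \<rho> (g \<otimes> ?b) *\<^sub>v e" using g b e by (simp add: \<rho>.rep_action_mult)
    also have "g \<otimes> ?b = ?t \<otimes> ?x" using g b t by (simp add: m_assoc[symmetric])
    also have "\<rho> \<dots> *\<^sub>v e = \<rho> ?t *\<^sub>v (\<rho> ?x *\<^sub>v e)"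
      using t x e by (intro \<rho>.rep_action_mult) auto
    also have "\<dots> = \<chi> ?x \<cdot>\<^sub>v (\<rho> ?t *\<^sub>v e)"
      using t x e eig by (simp add: mult_mat_vec[of _ n n])
    \<comment> \<open>The added terms are all 0; with them the coefficients are column
      \<open>j\<close> of the induced matrix.\<close>
    also have "\<dots> = vec_sum n H (\<lambda>s. \<chi> (inv s \<otimes> g \<otimes> ?b) \<cdot>\<^sub>v (\<rho> s *\<^sub>v e))"
    proof (rule eq_vecI)
      fix i assume "i < dim_vec (vec_sum n H (\<lambda>s. \<chi> (inv s \<otimes> g \<otimes> ?b) \<cdot>\<^sub>v (\<rho> s *\<^sub>v e)))"
      then have i: "i < n" by (simp add: vec_sum_def)
      have ix: "(c \<cdot>\<^sub>v (\<rho> s *\<^sub>v e)) $ i = c * (\<rho> s *\<^sub>v e) $ i" if "s \<in> H" for s c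
        using carrier_vecD[OF \<rho>.rep_action_carrier[OF H.mem_carrier[OF that] e(1)]] i by simp
      have "(\<Sum>s\<in>H. \<chi> (inv s \<otimes> g \<otimes> ?b) * (\<rho> s *\<^sub>v e) $ i) = (\<Sum>s\<in>{?t}. \<chi> (inv s \<otimes> g \<otimes> ?b) * (\<rho> s *\<^sub>v e) $ i)"
        using t H.fin zero by (intro sum.mono_neutral_right) auto
      then show "(\<chi> ?x \<cdot>\<^sub>v (\<rho> ?t *\<^sub>v e)) $ i = vec_sum n H (\<lambda>s. \<chi> (inv s \<otimes> g \<otimes> ?b) \<cdot>\<^sub>v (\<rho> s *\<^sub>v e)) $ i"
        using i t g b by (simp add: vec_sum_def ix m_assoc)
    qed (use t e carrier_vecD[OF \<rho>.rep_action_carrier[OF H.mem_carrier[OF t] e(1)]] in \<open>simp add: vec_sum_def\<close>)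
    also have "\<dots> = vec_sum n {..<card H} (\<lambda>i. induced_rep \<chi> g $$ (i, j) \<cdot>\<^sub>v ?v i)"
      unfolding vec_sum_def using j
      by (subst sum.reindex_bij_betw[OF bij_transversal, symmetric]) (simp add: induced_rep_def)
    finally show "\<rho> g *\<^sub>v ?v j = vec_sum n {..<card H} (\<lambda>i. induced_rep \<chi> g $$ (i, j) \<cdot>\<^sub>v ?v i)" .
  qed (use that in auto)
  then have "character_of G \<rho> = character_of G (induced_rep \<chi>)"
    by (auto simp: character_of_def)
  then show ?thesis using character_of_induced_rep by metis
qed

text \<open>Any nonzero vector, here the first unit vector, has a nonzero isotypic part for K. If
  its character is principal, K fixes this part and the representation is lifted; otherwise it is
  induced.\<close>

theorem Irr_eq: "Irr G = lifted_char ` dual G H \<union> induced_char ` nonprincipal"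
proof (intro equalityI subsetI)
  fix \<theta> assume "\<theta> \<in> Irr G"
  then obtain n \<rho> where \<rho>: "irreducible_rep G n \<rho>" "\<theta> = character_of G \<rho>" by (auto simp: Irr_def)
  interpret \<rho>: matrix_rep G n \<rho> using is_group \<rho>(1) by (rule irreducible_rep_matrix_rep)
  have "n > 0" using \<rho> by (simp add: irreducible_rep_def)
  then have u: "unit_vec n 0 \<noteq> (0\<^sub>v n :: complex vec)" by simp
  obtain \<chi> where \<chi>: "\<chi> \<in> dual G K" "\<rho>.isotypic_part K \<chi> (unit_vec n 0) \<noteq> 0\<^sub>v n"
    using \<rho>.exists_isotypic_part[OF kernel _ u] by auto
  have eig: "\<rho> x *\<^sub>v \<rho>.isotypic_part K \<chi> (unit_vec n 0) = \<chi> x \<cdot>\<^sub>v \<rho>.isotypic_part K \<chi> (unit_vec n 0)"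
    if "x \<in> K" for x
    using \<rho>.isotypic_part_eigen[OF kernel \<chi>(1) _ that] by simp
  show "\<theta> \<in> lifted_char ` dual G H \<union> induced_char ` nonprincipal"
  proof (cases "\<chi> \<in> nonprincipal")
    case True
    then show ?thesis
      using eigenvector_induced[OF \<rho>(1) \<rho>.isotypic_part_carrier \<chi>(2) True eig] \<rho>(2) by auto
  next
    case False
    then have "\<chi> = (\<lambda>x. of_bool (x \<in> K))" using \<chi> by (simp add: nonprincipal_def)
    then have "\<rho> x *\<^sub>v \<rho>.isotypic_part K \<chi> (unit_vec n 0) = \<rho>.isotypic_part K \<chi> (unit_vec n 0)"
      if "x \<in> K" for x
      using eig[OF that] that by simp
    then show ?thesis
      using fixed_vector_lifted[OF \<rho>(1) \<rho>.isotypic_part_carrier \<chi>(2)] \<rho>(2) by auto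
  qed
next
  fix \<theta> assume "\<theta> \<in> lifted_char ` dual G H \<union> induced_char ` nonprincipal"
  then show "\<theta> \<in> Irr G"
    using lifted_rep_irreducible induced_rep_irreducible character_of_lifted_rep character_of_induced_rep
    unfolding Irr_def by (smt (verit) Un_iff imageE mem_Collect_eq)
qed

subsection \<open>Evaluation of the character sums\<close>

lemma induced_char_off_kernel:
  assumes "\<chi> \<in> dual G K" "g \<in> carrier G" "g \<notin> K"
  shows "induced_char \<chi> g = 0"
  using assms K.dual_zero[OF assms(1)] kernel_conj_iff[of _ g]
  by (simp add: induced_char_def)

lemma induced_char_on_kernel:
  "g \<in> K \<Longrightarrow> induced_char \<chi> g = (\<Sum>y\<in>H. twist y \<chi> g)"
  by (simp add: induced_char_def twist_def)

lemma lifted_char_one: "\<mu> \<in> dual G H \<Longrightarrow> lifted_char \<mu> \<one> = 1"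
  by (simp add: lifted_char_def H.dual_one)

lemma induced_char_one: "\<chi> \<in> dual G K \<Longrightarrow> induced_char \<chi> \<one> = of_nat (card H)"
  by (simp add: induced_char_def K.dual_one)

lemma inj_lifted_char: "inj_on lifted_char (dual G H)"
proof (rule inj_onI)
  fix \<mu> \<nu> assume \<mu>: "\<mu> \<in> dual G H" and \<nu>: "\<nu> \<in> dual G H" and e: "lifted_char \<mu> = lifted_char \<nu>"
  have "\<mu> y = \<nu> y" if "y \<in> H" for y
    using fun_cong[OF e, of y] that by (simp add: lifted_char_def)
  then show "\<mu> = \<nu>" using H.dual_zero[OF \<mu>] H.dual_zero[OF \<nu>] by (metis ext)
qed

lemma finite_nonprincipal: "finite nonprincipal"
  by (simp add: nonprincipal_def K.finite_dual)

lemma induced_char_twist: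
  assumes \<chi>: "\<chi> \<in> dual G K" and z: "z \<in> H"
  shows "induced_char (twist z \<chi>) = induced_char \<chi>"
proof (rule ext)
  fix g
  consider "g \<notin> carrier G" | "g \<in> carrier G" "g \<notin> K" | "g \<in> K" by auto
  then show "induced_char (twist z \<chi>) g = induced_char \<chi> g"
  proof cases
    case 1
    then show ?thesis by (simp add: induced_char_def)
  next
    case 2
    then show ?thesis using \<chi> z by (simp add: induced_char_off_kernel twist_in_dual)
  next
    case 3
    have "twist y (twist z \<chi>) g = twist (z \<otimes> y) \<chi> g" if y: "y \<in> H" for y
    proof -
      have "inv z \<otimes> (inv y \<otimes> g \<otimes> y) \<otimes> z = inv (y \<otimes> z) \<otimes> g \<otimes> (y \<otimes> z)"
        using 3 y z by (simp add: inv_mult_group m_assoc)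
      then show ?thesis using 3 y z H.comm[OF y z] by (simp add: twist_def kernel_conj)
    qed
    then have "induced_char (twist z \<chi>) g = (\<Sum>y\<in>H. twist (z \<otimes> y) \<chi> g)"
      using 3 by (simp add: induced_char_on_kernel)
    then show ?thesis
      using H.sum_translate[OF z, of "\<lambda>y. twist y \<chi> g"] 3 by (simp add: induced_char_on_kernel)
  qed
qed

text \<open>Pairing an induced character with \<open>\<psi>\<close> over K counts the twists equal
  to \<open>\<psi>\<close>, so the induced character remembers the orbit it came from.\<close>

lemma sum_induced_char:
  assumes "\<chi> \<in> dual G K" "\<psi> \<in> dual G K"
  shows "(\<Sum>x\<in>K. induced_char \<chi> x * cnj (\<psi> x)) = of_nat (card K * card {y\<in>H. twist y \<chi> = \<psi>})"
proof -
  have "(\<Sum>x\<in>K. induced_char \<chi> x * cnj (\<psi> x)) = (\<Sum>x\<in>K. \<Sum>y\<in>H. twist y \<chi> x * cnj (\<psi> x))"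
    by (simp add: induced_char_on_kernel sum_distrib_right)
  also have "\<dots> = (\<Sum>y\<in>H. \<Sum>x\<in>K. twist y \<chi> x * cnj (\<psi> x))"
    by (rule sum.swap)
  also have "\<dots> = (\<Sum>y\<in>H. if twist y \<chi> = \<psi> then of_nat (card K) else 0)"
    using assms by (intro sum.cong refl K.row_orthogonality) (auto simp: twist_in_dual)
  also have "\<dots> = of_nat (card K * card {y\<in>H. twist y \<chi> = \<psi>})"
    using H.fin by (simp add: sum.If_cases Int_def)
  finally show ?thesis .
qed

lemma induced_char_eq_iff:
  assumes "\<chi> \<in> dual G K" "\<psi> \<in> dual G K"
  shows "induced_char \<psi> = induced_char \<chi> \<longleftrightarrow> \<psi> \<in> (\<lambda>y. twist y \<chi>) ` H"
proof
  assume e: "induced_char \<psi> = induced_char \<chi>"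
  have "of_nat (card K * card {y\<in>H. twist y \<chi> = \<psi>}) =
      (of_nat (card K * card {y\<in>H. twist y \<psi> = \<psi>}) :: complex)"
    unfolding sum_induced_char[OF assms, symmetric] sum_induced_char[OF assms(2,2), symmetric] e ..
  then have "card K * card {y\<in>H. twist y \<chi> = \<psi>} = card K * card {y\<in>H. twist y \<psi> = \<psi>}"
    by (simp only: of_nat_eq_iff)
  \<comment> \<open>The identity is always counted, so equal pairings force some twist of
    \<open>\<chi>\<close> to be \<open>\<psi>\<close>.\<close>
  moreover have "card {y\<in>H. twist y \<psi> = \<psi>} > 0"
  proof -
    have "\<one> \<in> {y\<in>H. twist y \<psi> = \<psi>}" using twist_one[OF assms(2)] by simp
    then show ?thesis using H.fin by (auto simp: card_gt_0_iff simp del: H.one_mem)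
  qed
  ultimately have "card {y\<in>H. twist y \<chi> = \<psi>} > 0" using K.card_pos by simp
  then have "{y\<in>H. twist y \<chi> = \<psi>} \<noteq> {}" unfolding card_gt_0_iff by blast
  then show "\<psi> \<in> (\<lambda>y. twist y \<chi>) ` H" by blast
qed (use assms induced_char_twist in auto)

lemma card_induced_char_fibre:
  assumes "\<chi> \<in> nonprincipal"
  shows "card {\<psi>\<in>nonprincipal. induced_char \<psi> = induced_char \<chi>} = card H"
proof -
  have "{\<psi>\<in>nonprincipal. induced_char \<psi> = induced_char \<chi>} = (\<lambda>y. twist y \<chi>) ` H"
    using assms induced_char_eq_iff[OF nonprincipal_dual[OF assms]] twist_nonprincipal[OF assms]
    by (auto simp: nonprincipal_dual)
  moreover have "inj_on (\<lambda>y. twist y \<chi>) H"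
    using twist_inj[OF assms] by (auto simp: inj_on_def)
  ultimately show ?thesis by (simp add: card_image)
qed

lemma sum_induced_image:
  fixes F :: "('a \<Rightarrow> complex) \<Rightarrow> complex"
  shows "(\<Sum>\<chi>\<in>nonprincipal. F (induced_char \<chi>)) = of_nat (card H) * (\<Sum>\<theta>\<in>induced_char ` nonprincipal. F \<theta>)"
proof -
  have "(\<Sum>\<chi>\<in>nonprincipal. F (induced_char \<chi>)) =
     (\<Sum>\<theta>\<in>induced_char ` nonprincipal. \<Sum>\<chi>\<in>{\<chi>\<in>nonprincipal. induced_char \<chi> = \<theta>}. F (induced_char \<chi>))"
    by (rule sum.image_gen[OF finite_nonprincipal])
  also have "\<dots> = (\<Sum>\<theta>\<in>induced_char ` nonprincipal. of_nat (card H) * F \<theta>)"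
    using card_induced_char_fibre by (intro sum.cong refl) auto
  finally show ?thesis by (simp add: sum_distrib_left)
qed

text \<open>The two families are disjoint because their degrees are 1 and
  \<open>card H \<ge> 2\<close>. Dividing by \<open>card H\<close> corrects for each induced
  character arising from a full orbit.\<close>

lemma sum_Irr:
  fixes F :: "('a \<Rightarrow> complex) \<Rightarrow> complex"
  shows "(\<Sum>\<theta>\<in>Irr G. F \<theta>) = (\<Sum>\<mu>\<in>dual G H. F (lifted_char \<mu>))
     + (\<Sum>\<chi>\<in>nonprincipal. F (induced_char \<chi>)) / of_nat (card H)"
proof -
  have "\<theta> \<one> = 1" if "\<theta> \<in> lifted_char ` dual G H" for \<theta>
    using that lifted_char_one by auto
  moreover have "\<theta> \<one> \<noteq> 1" if "\<theta> \<in> induced_char ` nonprincipal" for \<theta>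
    using that induced_char_one[OF nonprincipal_dual] card_complement_ge_2 by auto
  ultimately have "lifted_char ` dual G H \<inter> induced_char ` nonprincipal = {}" by blast
  then have "(\<Sum>\<theta>\<in>Irr G. F \<theta>) = (\<Sum>\<theta>\<in>lifted_char ` dual G H. F \<theta>) + (\<Sum>\<theta>\<in>induced_char ` nonprincipal. F \<theta>)"
    unfolding Irr_eq using finite_nonprincipal H.finite_dual by (intro sum.union_disjoint) auto
  then show ?thesis
    using sum_induced_image[of F] H.card_pos
    by (simp add: sum.reindex[OF inj_lifted_char])
qed

definition conj_count :: "'a \<Rightarrow> 'a \<Rightarrow> nat" where
  "conj_count g g' = card {z\<in>H. g = inv z \<otimes> g' \<otimes> z}"

lemma sum_nonprincipal:
  assumes "x \<in> K" "x' \<in> K"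
  shows "(\<Sum>\<chi>\<in>nonprincipal. \<chi> x * cnj (\<chi> x')) = (if x = x' then of_nat (card K) else 0) - 1"
proof -
  have "(\<Sum>\<chi>\<in>nonprincipal. \<chi> x * cnj (\<chi> x')) =
     (\<Sum>\<chi>\<in>dual G K. \<chi> x * cnj (\<chi> x')) - of_bool (x \<in> K) * cnj (of_bool (x' \<in> K))"
    unfolding nonprincipal_def using K.principal_in_dual
    by (subst sum_diff1[OF K.finite_dual]) simp
  then show ?thesis using assms by (simp add: K.column_orthogonality)
qed

lemma sum_induced_chars_kernel:
  assumes g: "g \<in> K" "g' \<in> K"
  shows "(\<Sum>\<chi>\<in>nonprincipal. induced_char \<chi> g * cnj (induced_char \<chi> g')) =
    of_nat (card H) * (of_nat (card K) * of_nat (conj_count g g') - of_nat (card H))"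
proof -
  let ?c = "\<lambda>y x. inv y \<otimes> x \<otimes> y"
  have "(\<Sum>\<chi>\<in>nonprincipal. induced_char \<chi> g * cnj (induced_char \<chi> g')) =
     (\<Sum>\<chi>\<in>nonprincipal. \<Sum>y\<in>H. \<Sum>z\<in>H. \<chi> (?c y g) * cnj (\<chi> (?c z g')))"
    using g by (simp add: induced_char_def sum_product)
  also have "\<dots> = (\<Sum>y\<in>H. \<Sum>\<chi>\<in>nonprincipal. \<Sum>z\<in>H. \<chi> (?c y g) * cnj (\<chi> (?c z g')))"
    by (rule sum.swap)
  also have "\<dots> = (\<Sum>y\<in>H. \<Sum>z\<in>H. \<Sum>\<chi>\<in>nonprincipal. \<chi> (?c y g) * cnj (\<chi> (?c z g')))"
    by (intro sum.cong refl sum.swap)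
  also have "\<dots> = (\<Sum>y\<in>H. \<Sum>z\<in>H. (if ?c y g = ?c z g' then of_nat (card K) else 0) - 1)"
    using g by (intro sum.cong refl sum_nonprincipal) (auto simp: kernel_conj)
  also have "\<dots> = (\<Sum>y\<in>H. \<Sum>z\<in>H. (if g = ?c z g' then of_nat (card K) else 0) - 1)"
  proof (rule sum.cong[OF refl])
    fix y assume y: "y \<in> H"
    \<comment> \<open>Replacing \<open>z\<close> by \<open>y \<otimes> z\<close> removes
      \<open>y\<close> from the condition, so the sum over \<open>y\<close> becomes a factor
      \<open>card H\<close>.\<close>
    have "?c y g = ?c (y \<otimes> z) g' \<longleftrightarrow> g = ?c z g'" if z: "z \<in> H" for z
    proof -
      have "?c (y \<otimes> z) g' = ?c y (?c z g')"
        using y z g H.comm[OF y z] by (simp add: inv_mult_group m_assoc)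
      then show ?thesis using y z g by simp
    qed
    then show "(\<Sum>z\<in>H. (if ?c y g = ?c z g' then of_nat (card K) else 0) - 1) =
      (\<Sum>z\<in>H. (if g = ?c z g' then of_nat (card K) else 0) - (1 :: complex))"
      by (subst H.sum_translate[OF y, symmetric]) simp
  qed
  also have "\<dots> = of_nat (card H) * (of_nat (card K) * of_nat (conj_count g g') - of_nat (card H))"
    using H.fin by (simp add: sum_subtractf sum.If_cases Int_def conj_count_def mult.commute)
  finally show ?thesis .
qed

text \<open>The induced part carries \<open>card H ^ 2\<close> from the degrees and one more
  \<open>card H\<close> from the sum over K's characters, which cancels against the fibre
  size.\<close>

lemma weighted_character_sum:
  assumes g: "g \<in> carrier G" "g' \<in> carrier G"
  shows "(\<Sum>\<theta>\<in>Irr G. char_degree G \<theta> ^ 2 * \<theta> g * cnj (\<theta> g')) =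
    (if pr g = pr g' then of_nat (card H) else 0) +
    (if g \<in> K \<and> g' \<in> K then of_nat (card H) ^ 2 *
       (of_nat (card K) * of_nat (conj_count g g') - of_nat (card H)) else 0)"
proof -
  have 1: "(\<Sum>\<mu>\<in>dual G H. char_degree G (lifted_char \<mu>) ^ 2 * lifted_char \<mu> g * cnj (lifted_char \<mu> g'))
     = (if pr g = pr g' then of_nat (card H) else 0)"
  proof -
    have "(\<Sum>\<mu>\<in>dual G H. char_degree G (lifted_char \<mu>) ^ 2 * lifted_char \<mu> g * cnj (lifted_char \<mu> g'))
      = (\<Sum>\<mu>\<in>dual G H. \<mu> (pr g) * cnj (\<mu> (pr g')))"
      using g by (simp add: char_degree_def lifted_char_one) (simp add: lifted_char_def)
    then show ?thesis using g by (simp add: H.column_orthogonality pr_mem)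
  qed
  have "(\<Sum>\<chi>\<in>nonprincipal. char_degree G (induced_char \<chi>) ^ 2 * induced_char \<chi> g * cnj (induced_char \<chi> g'))
     = of_nat (card H) ^ 2 * (\<Sum>\<chi>\<in>nonprincipal. induced_char \<chi> g * cnj (induced_char \<chi> g'))"
    by (simp add: char_degree_def induced_char_one nonprincipal_dual sum_distrib_left mult.assoc)
  also have "(\<Sum>\<chi>\<in>nonprincipal. induced_char \<chi> g * cnj (induced_char \<chi> g')) =
    (if g \<in> K \<and> g' \<in> K then of_nat (card H) * (of_nat (card K) * of_nat (conj_count g g') - of_nat (card H)) else 0)"
    using g sum_induced_chars_kernel by (auto simp: induced_char_off_kernel nonprincipal_dual intro!: sum.neutral)
  finally show ?thesis
    using 1 H.card_pos by (simp add: sum_Irr power2_eq_square)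
qed

section \<open>Conjugation counts and the sum of absolute values\<close>

lemma conj_count_one_one: "conj_count \<one> \<one> = card H"
proof -
  have "{z\<in>H. \<one> = inv z \<otimes> \<one> \<otimes> z} = H" by auto
  then show ?thesis by (simp add: conj_count_def)
qed

lemma conj_count_one_right:
  assumes "g \<noteq> \<one>"
  shows "conj_count g \<one> = 0"
proof -
  have e: "{z\<in>H. g = inv z \<otimes> \<one> \<otimes> z} = {}" using assms by auto
  show ?thesis unfolding conj_count_def e by simp
qed

definition complement_orbit :: "'a \<Rightarrow> 'a set" where
  "complement_orbit g = (\<lambda>z. inv z \<otimes> g \<otimes> z) ` H"

text \<open>Equal conjugates of \<open>x\<close> by \<open>y\<close> and \<open>z\<close> make
  \<open>y \<otimes> inv z\<close> commute with \<open>x\<close>.\<close>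

lemma inj_complement_action:
  assumes x: "x \<in> K" "x \<noteq> \<one>"
  shows "inj_on (\<lambda>z. inv z \<otimes> x \<otimes> z) H"
proof (rule inj_onI)
  fix y z assume y: "y \<in> H" and z: "z \<in> H" and e: "inv y \<otimes> x \<otimes> y = inv z \<otimes> x \<otimes> z"
  have "x \<otimes> (y \<otimes> inv z) = y \<otimes> (inv y \<otimes> x \<otimes> y) \<otimes> inv z"
    using x y z by (simp add: m_assoc mult_inv_cancel_left)
  also have "\<dots> = (y \<otimes> inv z) \<otimes> x"
    unfolding e using x y z by (simp add: m_assoc)
  finally have "y \<otimes> inv z = \<one>"
    using fixed_point_free[of x "y \<otimes> inv z"] x y z by auto
  then show "y = z" using mult_inv_eq_one[of y z] y z by simp
qed

lemma complement_orbit_props: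
  assumes x: "x \<in> K" "x \<noteq> \<one>"
  shows "complement_orbit x \<subseteq> K - {\<one>}" "card (complement_orbit x) = card H"
    "conj_count g x = of_bool (g \<in> complement_orbit x)"
proof -
  show "complement_orbit x \<subseteq> K - {\<one>}"
  proof
    fix u assume "u \<in> complement_orbit x"
    then obtain z where z: "z \<in> H" "u = inv z \<otimes> x \<otimes> z" by (auto simp: complement_orbit_def)
    have "u \<noteq> \<one>"
    proof
      assume "u = \<one>"
      then have "z \<otimes> (inv z \<otimes> x \<otimes> z) \<otimes> inv z = \<one>" using z by simp
      then show False using x z by (simp add: m_assoc mult_inv_cancel_left)
    qed
    then show "u \<in> K - {\<one>}" using z x by (simp add: kernel_conj)
  qed
  show "card (complement_orbit x) = card H"
    unfolding complement_orbit_def by (rule card_image[OF inj_complement_action[OF x]])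
  show "conj_count g x = of_bool (g \<in> complement_orbit x)"
  proof (cases "g \<in> complement_orbit x")
    case True
    then obtain z where z: "z \<in> H" "g = inv z \<otimes> x \<otimes> z" by (auto simp: complement_orbit_def)
    have "y = z" if "y \<in> H" "g = inv y \<otimes> x \<otimes> y" for y
      using inj_onD[OF inj_complement_action[OF x] _ that(1) z(1)] that(2) z(2) by metis
    then have e: "{y\<in>H. g = inv y \<otimes> x \<otimes> y} = {z}" using z by blast
    show ?thesis unfolding conj_count_def e using True by simp
  next
    case False
    then have e: "{y\<in>H. g = inv y \<otimes> x \<otimes> y} = {}" unfolding complement_orbit_def by blast
    show ?thesis unfolding conj_count_def e using False by simp
  qed
qed

text \<open>The orbit of a nontrivial kernel element has \<open>card H\<close> members and misses
  the identity. This bound settles the signs in the absolute values.\<close>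

lemma complement_less_kernel: "card H + 1 \<le> card K"
proof -
  obtain x where x: "x \<in> K" "x \<noteq> \<one>" using kernel_nontrivial K.one_mem by blast
  have "card H \<le> card (K - {\<one>})"
    using complement_orbit_props(1,2)[OF x] K.fin by (metis card_mono finite_Diff)
  moreover have "card (K - {\<one>}) = card K - 1" by simp
  ultimately show ?thesis using K.card_pos by linarith
qed

text \<open>For \<open>x = \<one>\<close> one entry has count h and the other k - 1 have count 0;
  otherwise h entries have count 1 and k - h have count 0. Only count 0 gives a negative value, h -
  h^3, whose sign is reversed.\<close>

lemma kernel_row_sum:
  assumes x: "x \<in> K"
  defines "h \<equiv> real (card H)" and "k \<equiv> real (card K)"
  shows "(\<Sum>g\<in>K. \<bar>h + h ^ 2 * (k * real (conj_count g x) - h)\<bar>) =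
    (if x = \<one> then (h + h ^ 3 * k - h ^ 3) + (k - 1) * (h ^ 3 - h)
     else h * (h + h ^ 2 * k - h ^ 3) + (k - h) * (h ^ 3 - h))"
proof -
  have h: "h \<ge> 2" and hk: "h + 1 \<le> k"
    using card_complement_ge_2 complement_less_kernel by (simp_all add: h_def k_def flip: of_nat_Suc)
  have h3: "h \<le> h ^ 3" using h power_increasing[of 1 3 h] by simp
  then have zero: "\<bar>h + h ^ 2 * (k * 0 - h)\<bar> = h ^ 3 - h"
    by (simp add: power3_eq_cube power2_eq_square abs_if)
  show ?thesis
  proof (cases "x = \<one>")
    case True
    have "h ^ 3 * 1 \<le> h ^ 3 * k" using h hk by (intro mult_left_mono) auto
    then have "h + h ^ 3 * k - h ^ 3 \<ge> 0" using h by linarith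
    moreover have "h + h ^ 2 * (k * h - h) = h + h ^ 3 * k - h ^ 3"
      by (simp add: power3_eq_cube power2_eq_square algebra_simps)
    ultimately have one: "\<bar>h + h ^ 2 * (k * real (conj_count \<one> \<one>) - h)\<bar> = h + h ^ 3 * k - h ^ 3"
      by (simp add: conj_count_one_one h_def)
    have "(\<Sum>g\<in>K. \<bar>h + h ^ 2 * (k * real (conj_count g x) - h)\<bar>) =
      \<bar>h + h ^ 2 * (k * real (conj_count \<one> x) - h)\<bar> + (\<Sum>g\<in>K - {\<one>}. \<bar>h + h ^ 2 * (k * real (conj_count g x) - h)\<bar>)"
      by (rule sum.remove[OF K.fin K.one_mem])
    also have "(\<Sum>g\<in>K - {\<one>}. \<bar>h + h ^ 2 * (k * real (conj_count g x) - h)\<bar>) = (\<Sum>g\<in>K - {\<one>}. h ^ 3 - h)"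
      using True zero by (intro sum.cong) (auto simp: conj_count_one_right)
    also have "\<dots> = (k - 1) * (h ^ 3 - h)"
      using K.fin K.card_pos by (simp add: card_Diff_singleton k_def of_nat_diff Suc_leI)
    finally show ?thesis using one True by simp
  next
    case False
    note O = complement_orbit_props[OF x False]
    have "h ^ 3 \<le> h ^ 2 * k"
      using mult_left_mono[of h k "h ^ 2"] h hk by (simp add: power3_eq_cube power2_eq_square)
    moreover have e: "h + h ^ 2 * (k * 1 - h) = h + h ^ 2 * k - h ^ 3"
      by (simp add: power3_eq_cube power2_eq_square algebra_simps)
    ultimately have "h + h ^ 2 * k - h ^ 3 \<ge> 0"
      using h by linarith
    with e have one: "\<bar>h + h ^ 2 * (k * 1 - h)\<bar> = h + h ^ 2 * k - h ^ 3" by simp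
    let ?O = "complement_orbit x"
    have OK: "?O \<subseteq> K" using O(1) by blast
    have fO: "finite ?O" using OK K.fin by (rule finite_subset)
    have "(\<Sum>g\<in>K. \<bar>h + h ^ 2 * (k * real (conj_count g x) - h)\<bar>) =
      (\<Sum>g\<in>K - ?O. \<bar>h + h ^ 2 * (k * real (conj_count g x) - h)\<bar>) + (\<Sum>g\<in>?O. \<bar>h + h ^ 2 * (k * real (conj_count g x) - h)\<bar>)"
      by (rule sum.subset_diff[OF OK K.fin])
    also have "(\<Sum>g\<in>K - ?O. \<bar>h + h ^ 2 * (k * real (conj_count g x) - h)\<bar>) = (\<Sum>g\<in>K - ?O. h ^ 3 - h)"
      using zero by (intro sum.cong) (auto simp: O(3))
    also have "(\<Sum>g\<in>?O. \<bar>h + h ^ 2 * (k * real (conj_count g x) - h)\<bar>) = (\<Sum>g\<in>?O. h + h ^ 2 * k - h ^ 3)"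
      using one by (intro sum.cong) (auto simp: O(3))
    also have "(\<Sum>g\<in>K - ?O. h ^ 3 - h) = (k - h) * (h ^ 3 - h)"
      using card_Diff_subset[OF fO OK] card_mono[OF K.fin OK] O(2) by (simp add: h_def k_def of_nat_diff)
    also have "(\<Sum>g\<in>?O. h + h ^ 2 * k - h ^ 3) = h * (h + h ^ 2 * k - h ^ 3)"
      using O(2) by (simp add: h_def)
    finally show ?thesis using False by simp
  qed
qed

lemma AM_Z_eq:
  defines "h \<equiv> real (card H)" and "k \<equiv> real (card K)"
  shows "AM_Z G = 1 + 2 * ((h ^ 2 - 1) / h) * (1 - (h - 1) / k) * (1 - 1 / k)"
proof -
  let ?S = "\<lambda>g g'. cmod (\<Sum>\<theta>\<in>Irr G. char_degree G \<theta> ^ 2 * \<theta> g * cnj (\<theta> g'))"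
  let ?r = "\<lambda>g x. \<bar>h + h ^ 2 * (k * real (conj_count g x) - h)\<bar>"
  let ?core = "\<Sum>x\<in>K. \<Sum>g\<in>K. ?r g x"
  have hpos: "h > 0" and kpos: "k > 0" by (simp_all add: h_def k_def)
  have pr_prod: "pr (t \<otimes> x) = t" if "t \<in> H" "x \<in> K" for t x
    using that by (simp add: pr_mult pr_of_kernel)
  have inK: "t \<otimes> x \<in> K \<longleftrightarrow> t = \<one>" if "t \<in> H" "x \<in> K" for t x
    using that pr_kernel[of "t \<otimes> x"] pr_prod[OF that] by simp
  have S: "?S (t \<otimes> x) (t' \<otimes> x') = (if t \<noteq> t' then 0 else if t \<noteq> \<one> then h else ?r x x')"
    if m: "t \<in> H" "t' \<in> H" "x \<in> K" "x' \<in> K" for t t' x x'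
  proof -
    have "(\<Sum>\<theta>\<in>Irr G. char_degree G \<theta> ^ 2 * \<theta> (t \<otimes> x) * cnj (\<theta> (t' \<otimes> x'))) =
      of_real (if t \<noteq> t' then 0 else if t \<noteq> \<one> then h else h + h ^ 2 * (k * real (conj_count x x') - h))"
      using m by (subst weighted_character_sum) (auto simp: pr_prod inK h_def k_def)
    then have "?S (t \<otimes> x) (t' \<otimes> x') =
       cmod (of_real (if t \<noteq> t' then 0 else if t \<noteq> \<one> then h else h + h ^ 2 * (k * real (conj_count x x') - h)))"
      by (rule arg_cong)
    then show ?thesis using hpos by (simp only: norm_of_real) auto
  qed
  have "(\<Sum>g\<in>carrier G. \<Sum>g'\<in>carrier G. ?S g g') =
    (\<Sum>t\<in>H. \<Sum>x\<in>K. \<Sum>t'\<in>H. \<Sum>x'\<in>K. ?S (t \<otimes> x) (t' \<otimes> x'))"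
    by (simp only: sum_carrier)
  also have "\<dots> = (\<Sum>t\<in>H. \<Sum>x\<in>K. \<Sum>t'\<in>H. if t = t' then \<Sum>x'\<in>K. if t \<noteq> \<one> then h else ?r x x' else 0)"
    using S by (intro sum.cong refl) simp
  also have "\<dots> = (\<Sum>t\<in>H. \<Sum>x\<in>K. \<Sum>x'\<in>K. if t \<noteq> \<one> then h else ?r x x')"
    by (rule sum.cong[OF refl], rule sum.cong[OF refl]) (use H.fin in simp)
  also have "\<dots> = (\<Sum>x\<in>K. \<Sum>x'\<in>K. ?r x x') + (\<Sum>t\<in>H - {\<one>}. \<Sum>x\<in>K. \<Sum>x'\<in>K. h)"
    using H.fin by (subst sum.remove[of _ \<one>]) auto
  also have "(\<Sum>t\<in>H - {\<one>}. \<Sum>x\<in>K. \<Sum>x'\<in>K. h) = (h - 1) * k ^ 2 * h"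
    using H.fin by (simp add: card_Diff_singleton h_def k_def of_nat_diff Suc_leI power2_eq_square)
  \<comment> \<open>The row sums run over the first argument of \<open>?r\<close>, so that sum has
    to be the inner one.\<close>
  also have "(\<Sum>x\<in>K. \<Sum>x'\<in>K. ?r x x') = ?core"
    by (rule sum.swap)
  also have "?core = (\<Sum>x\<in>K. if x = \<one> then (h + h ^ 3 * k - h ^ 3) + (k - 1) * (h ^ 3 - h)
     else h * (h + h ^ 2 * k - h ^ 3) + (k - h) * (h ^ 3 - h))"
    unfolding h_def k_def by (intro sum.cong refl kernel_row_sum)
  also have "\<dots> = (h + h ^ 3 * k - h ^ 3) + (k - 1) * (h ^ 3 - h)
      + (k - 1) * (h * (h + h ^ 2 * k - h ^ 3) + (k - h) * (h ^ 3 - h))"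
    using K.fin by (subst sum.remove[of _ \<one>]) (auto simp: card_Diff_singleton k_def of_nat_diff Suc_leI)
  finally have total: "AM_Z G = 1 / (h * k) ^ 2 * ((h + h ^ 3 * k - h ^ 3) + (k - 1) * (h ^ 3 - h)
      + (k - 1) * (h * (h + h ^ 2 * k - h ^ 3) + (k - h) * (h ^ 3 - h)) + (h - 1) * k ^ 2 * h)"
    by (simp add: AM_Z_sum_over_group[OF is_group finite_carrier] order_eq h_def k_def)
  show ?thesis
    unfolding total using hpos kpos
    by (simp add: field_simps power2_eq_square power3_eq_cube)
qed

end

section \<open>The Frobenius kernel\<close>

context group
begin

lemma conj_set_eq:
  assumes "g \<in> carrier G" "H \<subseteq> carrier G"
  shows "conj_set G g H = (\<lambda>u. g \<otimes> u \<otimes> inv g) ` H"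
  by (auto simp: conj_set_def l_coset_def r_coset_def)

text \<open>A commuting \<open>g\<close> fixes \<open>u\<close> under conjugation, so
  \<open>u\<close> lies in both H and its conjugate by \<open>g\<close>.\<close>

lemma malnormal_commute:
  assumes H: "subgroup H G" "malnormal H G" and u: "u \<in> H" "u \<noteq> \<one>"
    and g: "g \<in> carrier G" "g \<otimes> u = u \<otimes> g"
  shows "g \<in> H"
proof (rule ccontr)
  assume "g \<notin> H"
  then have e: "H \<inter> conj_set G g H = {\<one>}" using H(2) g(1) by (simp add: malnormal_def)
  have uc: "u \<in> carrier G" using H(1) u(1) subgroup.subset by blast
  have "u = g \<otimes> u \<otimes> inv g" using g uc by (simp add: m_assoc)
  then have "u \<in> conj_set G g H"
    using conj_set_eq[OF g(1), of H] H(1) u(1) subgroup.subset by blast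
  then show False using e u by blast
qed

text \<open>Only \<open>u = \<one>\<close> has the identity as a conjugate, so the identity adjoined
  in the definition is absorbed by asking that \<open>x\<close> be conjugate to no nontrivial
  element of H.\<close>

lemma frobenius_kernel_iff:
  assumes "H \<subseteq> carrier G"
  shows "x \<in> frobenius_kernel H G \<longleftrightarrow>
    x \<in> carrier G \<and> (\<forall>g\<in>carrier G. \<forall>u\<in>H. x = g \<otimes> u \<otimes> inv g \<longrightarrow> u = \<one>)"
proof -
  have "g \<otimes> u \<otimes> inv g = \<one> \<longleftrightarrow> u = \<one>" if "g \<in> carrier G" "u \<in> H" for g u
  proof
    assume e: "g \<otimes> u \<otimes> inv g = \<one>"
    have uc: "u \<in> carrier G" using that assms by blast
    have "u = inv g \<otimes> (g \<otimes> u \<otimes> inv g) \<otimes> g"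
      using that uc by (simp add: m_assoc inv_mult_cancel_left)
    then show "u = \<one>" using e that by simp
  qed (use that in simp)
  moreover have "x = \<one>" if "\<exists>g\<in>carrier G. x = g \<otimes> \<one> \<otimes> inv g" using that by auto
  ultimately show ?thesis
    unfolding frobenius_kernel_def using assms
    by (auto simp: conj_set_eq) metis+
qed

text \<open>Each nontrivial conjugate \<open>g u g\<^sup>-\<^sup>1\<close> of an element of \<open>H\<close> arises from exactly \<open>|H|\<close>
  pairs \<open>(g, u)\<close>.\<close>

lemma card_frobenius_kernel:
  assumes fin: "finite (carrier G)" and H: "subgroup H G" "malnormal H G"
  shows "card H * card (frobenius_kernel H G) = card (carrier G)"
proof -
  interpret H: subgroup H G by (rule H)
  have Hc: "H \<subseteq> carrier G" by (rule H.subset)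
  have finH: "finite H" using Hc fin by (rule finite_subset)
  let ?P = "carrier G \<times> (H - {\<one>})"
  let ?f = "\<lambda>(g, u). g \<otimes> u \<otimes> inv g"
  let ?U = "carrier G - frobenius_kernel H G"
  have U: "?f ` ?P = ?U"
  proof (intro equalityI subsetI)
    fix x assume "x \<in> ?f ` ?P"
    then show "x \<in> ?U" using Hc by (auto simp: frobenius_kernel_iff[OF Hc])
  next
    fix x assume "x \<in> ?U"
    then obtain g u where "g \<in> carrier G" "u \<in> H" "x = g \<otimes> u \<otimes> inv g" "u \<noteq> \<one>"
      by (auto simp: frobenius_kernel_iff[OF Hc])
    then show "x \<in> ?f ` ?P" by (intro image_eqI[of _ _ "(g, u)"]) auto
  qed
  have fibre: "card {p\<in>?P. ?f p = x} = card H" if x: "x \<in> ?U" for x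
  proof -
    obtain g u where gu: "g \<in> carrier G" "u \<in> H" "u \<noteq> \<one>" "x = g \<otimes> u \<otimes> inv g"
      using x unfolding U[symmetric] by auto
    have uc: "u \<in> carrier G" using gu Hc by blast
    let ?j = "\<lambda>t. (g \<otimes> t, inv t \<otimes> u \<otimes> t)"
    \<comment> \<open>Two pairs with the same value differ by
      \<open>?t = inv g \<otimes> g'\<close>, which carries a nontrivial element of H into H and so
      lies in H by malnormality.\<close>
    have "{p\<in>?P. ?f p = x} = ?j ` H"
    proof (intro equalityI subsetI)
      fix p assume "p \<in> {p\<in>?P. ?f p = x}"
      then obtain g' u' where p: "p = (g', u')" "g' \<in> carrier G" "u' \<in> H" "u' \<noteq> \<one>"
        "g' \<otimes> u' \<otimes> inv g' = g \<otimes> u \<otimes> inv g" using gu by auto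
      have u'c: "u' \<in> carrier G" using p Hc by blast
      let ?t = "inv g \<otimes> g'"
      have "?t \<otimes> u' \<otimes> inv ?t = inv g \<otimes> (g' \<otimes> u' \<otimes> inv g') \<otimes> g"
        using gu(1) p(2) u'c by (simp add: inv_mult_group m_assoc)
      also have "\<dots> = u"
        unfolding p(5) using gu uc by (simp add: m_assoc inv_mult_cancel_left)
      finally have tu: "?t \<otimes> u' \<otimes> inv ?t = u" .
      have tH: "?t \<in> H"
      proof (rule ccontr)
        assume "?t \<notin> H"
        then have e: "H \<inter> conj_set G ?t H = {\<one>}" using H(2) gu p by (simp add: malnormal_def)
        have "u \<in> conj_set G ?t H"
          unfolding conj_set_eq[OF m_closed[OF inv_closed[OF gu(1)] p(2)] Hc] using tu p(3) by auto
        then show False using e gu by blast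
      qed
      have "u' = inv ?t \<otimes> (?t \<otimes> u' \<otimes> inv ?t) \<otimes> ?t"
        using gu(1) p(2) u'c by (simp add: inv_mult_group m_assoc mult_inv_cancel_left inv_mult_cancel_left)
      then have "u' = inv ?t \<otimes> u \<otimes> ?t" unfolding tu .
      moreover have "g' = g \<otimes> ?t" using gu(1) p(2) by (simp add: mult_inv_cancel_left)
      ultimately show "p \<in> ?j ` H" using tH p(1) by blast
    next
      fix p assume "p \<in> ?j ` H"
      then obtain t where t: "t \<in> H" "p = ?j t" by blast
      have tc: "t \<in> carrier G" using t Hc by blast
      have ne: "inv t \<otimes> u \<otimes> t \<noteq> \<one>"
      proof
        assume e: "inv t \<otimes> u \<otimes> t = \<one>"
        have "u = t \<otimes> (inv t \<otimes> u \<otimes> t) \<otimes> inv t"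
          using tc uc by (simp add: m_assoc mult_inv_cancel_left)
        then show False unfolding e using tc gu by simp
      qed
      have "(g \<otimes> t) \<otimes> (inv t \<otimes> u \<otimes> t) \<otimes> inv (g \<otimes> t) = x"
        using gu tc uc by (simp add: inv_mult_group m_assoc mult_inv_cancel_left)
      then show "p \<in> {p\<in>?P. ?f p = x}" using t gu tc ne by auto
    qed
    moreover have "inj_on ?j H" using gu Hc by (auto simp: inj_on_def)
    ultimately show ?thesis by (simp add: card_image)
  qed
  have "card ?P = (\<Sum>x\<in>?f ` ?P. card {p\<in>?P. ?f p = x})"
    using sum.image_gen[of ?P "\<lambda>_. 1::nat" ?f] fin finH by simp
  also have "\<dots> = card H * card ?U"
    unfolding U using fibre by simp
  finally have *: "card (carrier G) * card (H - {\<one>}) = card H * card ?U"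
    by (simp add: card_cartesian_product)
  have Kc: "frobenius_kernel H G \<subseteq> carrier G" using frobenius_kernel_iff[OF Hc] by blast
  \<comment> \<open>Writing the cardinalities as sums turns the double count into an identity free
    of natural subtraction.\<close>
  obtain b where b: "card H = Suc b" "card (H - {\<one>}) = b"
    using finH H.one_closed by (metis card.remove)
  obtain d where d: "card (carrier G) = card (frobenius_kernel H G) + d"
    using le_Suc_ex[OF card_mono[OF fin Kc]] by blast
  have card_U: "card ?U = d"
    using card_Diff_subset[OF finite_subset[OF Kc fin] Kc] d by simp
  show ?thesis using * unfolding b card_U d by (simp add: algebra_simps)
qed

text \<open>Multiplication from H times K to G is injective since H and K meet trivially, and the
  cardinality formula makes it surjective.\<close>

lemma frobenius_pairI:
  assumes fin: "finite (carrier G)" and fc: "frobenius_complement H G"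
    and commH: "commutative_on H G" and commK: "commutative_on (frobenius_kernel H G) G"
  shows "frobenius_pair G (frobenius_kernel H G) H"
proof -
  have H: "subgroup H G" "malnormal H G" "H \<noteq> carrier G" "H \<noteq> {\<one>}"
    using fc by (simp_all add: frobenius_complement_def)
  interpret H: subgroup H G by (rule H)
  have Hc: "H \<subseteq> carrier G" by (rule H.subset)
  have finH: "finite H" using Hc fin by (rule finite_subset)
  let ?K = "frobenius_kernel H G"
  note Kiff = frobenius_kernel_iff[OF Hc]
  have Kc: "x \<in> carrier G" if "x \<in> ?K" for x using that Kiff by blast
  have KD: "u = \<one>" if "g \<otimes> u \<otimes> inv g \<in> ?K" "g \<in> carrier G" "u \<in> H" for g u
    using that Kiff by blast
  have one: "\<one> \<in> ?K" by (simp add: frobenius_kernel_def)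
  have conj: "inv g \<otimes> x \<otimes> g \<in> ?K" if x: "x \<in> ?K" and g: "g \<in> carrier G" for x g
    unfolding Kiff
  proof (intro conjI ballI impI)
    show "inv g \<otimes> x \<otimes> g \<in> carrier G" using Kc[OF x] g by simp
    fix a u assume a: "a \<in> carrier G" "u \<in> H" "inv g \<otimes> x \<otimes> g = a \<otimes> u \<otimes> inv a"
    have uc: "u \<in> carrier G" using a Hc by blast
    have "x = g \<otimes> (inv g \<otimes> x \<otimes> g) \<otimes> inv g"
      using Kc[OF x] g by (simp add: m_assoc mult_inv_cancel_left)
    also have "\<dots> = (g \<otimes> a) \<otimes> u \<otimes> inv (g \<otimes> a)"
      unfolding a(3) using g a uc by (simp add: m_assoc inv_mult_group)
    finally show "u = \<one>" using KD[of "g \<otimes> a" u] x a g by simp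
  qed
  have inH: "x = \<one>" if "x \<in> ?K" "x \<in> H" for x
    using KD[of \<one> x] that Kc by simp
  have fpf: "x = \<one> \<or> y = \<one>" if "x \<in> ?K" "y \<in> H" "x \<otimes> y = y \<otimes> x" for x y
    using malnormal_commute[OF H(1,2) that(2) _ Kc[OF that(1)] that(3)] inH[OF that(1)] by blast
  have mult: "x \<otimes> y \<in> ?K" if x: "x \<in> ?K" and y: "y \<in> ?K" for x y
    unfolding Kiff
  proof (intro conjI ballI impI)
    have xc: "x \<in> carrier G" and yc: "y \<in> carrier G" using x y Kc by auto
    show "x \<otimes> y \<in> carrier G" using xc yc by simp
    fix g u assume g: "g \<in> carrier G" "u \<in> H" and e: "x \<otimes> y = g \<otimes> u \<otimes> inv g"
    have uc: "u \<in> carrier G" using g Hc by blast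
    \<comment> \<open>Conjugating back by \<open>g\<close> puts the product into H itself;
      \<open>?x\<close> stays in K and commutes with \<open>u\<close>, so fixed-point freeness
      applies.\<close>
    let ?x = "inv g \<otimes> x \<otimes> g"
    have u: "u = inv g \<otimes> (x \<otimes> y) \<otimes> g"
      unfolding e using g uc by (simp add: m_assoc inv_mult_cancel_left)
    have "x \<otimes> y = y \<otimes> x" using commK x y by (simp add: commutative_on_def)
    then have "x \<otimes> (x \<otimes> y) = x \<otimes> (y \<otimes> x)" by (rule arg_cong)
    also have "\<dots> = (x \<otimes> y) \<otimes> x" using xc yc by (simp add: m_assoc)
    finally have "x \<otimes> (x \<otimes> y) = (x \<otimes> y) \<otimes> x" .
    moreover have "?x \<otimes> u = inv g \<otimes> (x \<otimes> (x \<otimes> y)) \<otimes> g"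
      unfolding u using xc yc g by (simp add: m_assoc mult_inv_cancel_left)
    moreover have "u \<otimes> ?x = inv g \<otimes> ((x \<otimes> y) \<otimes> x) \<otimes> g"
      unfolding u using xc yc g by (simp add: m_assoc mult_inv_cancel_left)
    ultimately have "?x = \<one> \<or> u = \<one>"
      using fpf[OF conj[OF x g(1)] g(2)] by simp
    then show "u = \<one>"
    proof
      assume e': "?x = \<one>"
      have "x = g \<otimes> ?x \<otimes> inv g" using xc g by (simp add: m_assoc mult_inv_cancel_left)
      then have "x = \<one>" unfolding e' using g by simp
      then show "u = \<one>" using KD[OF _ g] y e yc by simp
    qed
  qed
  have inv: "inv x \<in> ?K" if x: "x \<in> ?K" for x
    unfolding Kiff
  proof (intro conjI ballI impI)
    show "inv x \<in> carrier G" using Kc[OF x] by simp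
    fix g u assume g: "g \<in> carrier G" "u \<in> H" and e: "inv x = g \<otimes> u \<otimes> inv g"
    have uc: "u \<in> carrier G" using g Hc by blast
    have "x = inv (g \<otimes> u \<otimes> inv g)" using e Kc[OF x] by (metis inv_inv)
    also have "\<dots> = g \<otimes> inv u \<otimes> inv g" using g uc by (simp add: inv_mult_group m_assoc)
    finally have "inv u = \<one>" using KD[of g "inv u"] x g by simp
    then show "u = \<one>" using uc by (metis inv_inv inv_one)
  qed
  have subK: "subgroup ?K G"
    using Kc one mult inv by (intro subgroupI) auto
  have finK: "finite ?K" using fin Kc by (meson finite_subset subsetI)
  have card: "card H * card ?K = card (carrier G)"
    by (rule card_frobenius_kernel[OF fin H(1,2)])
  let ?m = "\<lambda>(t, x). t \<otimes> x"
  have uniq: "t = t'" if t: "t \<in> H" "t' \<in> H" "g \<in> carrier G" and "inv t \<otimes> g \<in> ?K" "inv t' \<otimes> g \<in> ?K" for t t' g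
  proof -
    have tc: "t \<in> carrier G" "t' \<in> carrier G" using t Hc by auto
    \<comment> \<open>This element lies in H by its left side and in K by its right side.\<close>
    have "inv t' \<otimes> t = (inv t' \<otimes> g) \<otimes> inv (inv t \<otimes> g)"
      using tc t by (simp add: inv_mult_group m_assoc mult_inv_cancel_left)
    then have "inv t' \<otimes> t \<in> ?K" using that mult inv by simp
    then have "inv t' \<otimes> t = \<one>" using inH t by simp
    then show ?thesis using inv_mult_eq_one tc by metis
  qed
  have inj: "inj_on ?m (H \<times> ?K)"
  proof (rule inj_onI)
    fix p q assume pq: "p \<in> H \<times> ?K" "q \<in> H \<times> ?K" "?m p = ?m q"
    obtain t x t' x' where p: "p = (t, x)" "q = (t', x')" by fastforce
    have c: "t \<in> carrier G" "t' \<in> carrier G" "x \<in> carrier G" "x' \<in> carrier G" using pq p Hc Kc by auto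
    have e: "t \<otimes> x = t' \<otimes> x'" using pq(3) p by simp
    have "inv t \<otimes> (t \<otimes> x) \<in> ?K"
      using pq(1) p c by (simp add: inv_mult_cancel_left)
    moreover have "inv t' \<otimes> (t \<otimes> x) \<in> ?K"
      unfolding e using pq(2) p c by (simp add: inv_mult_cancel_left)
    ultimately have "t = t'" using uniq[of t t' "t \<otimes> x"] pq(1,2) p c by simp
    then show "p = q" using e c p by simp
  qed
  have "?m ` (H \<times> ?K) = carrier G"
  proof (rule card_subset_eq[OF fin])
    show "?m ` (H \<times> ?K) \<subseteq> carrier G" using Hc Kc by auto
    show "card (?m ` (H \<times> ?K)) = card (carrier G)"
      using card by (simp add: card_image[OF inj] card_cartesian_product)
  qed
  then have decomp: "\<exists>t\<in>H. inv t \<otimes> g \<in> ?K" if "g \<in> carrier G" for g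
  proof -
    have "g \<in> ?m ` (H \<times> ?K)" using \<open>?m ` (H \<times> ?K) = carrier G\<close> that by simp
    then obtain t x where tx: "t \<in> H" "x \<in> ?K" "g = t \<otimes> x" by auto
    then have "inv t \<otimes> g = x" using Hc Kc by (auto simp: inv_mult_cancel_left)
    then show ?thesis using tx by blast
  qed
  have "?K \<noteq> {\<one>}"
  proof
    assume "?K = {\<one>}"
    then have "card H = card (carrier G)" using card by simp
    then show False using card_subset_eq[OF fin Hc] H(3) by simp
  qed
  show ?thesis
  proof (intro frobenius_pair.intro frobenius_pair_axioms.intro)
    show "finite_abelian_subgroup G ?K"
      using is_group subK finK commK
      by (simp add: finite_abelian_subgroup_def finite_abelian_subgroup_axioms_def commutative_on_def)
    show "finite_abelian_subgroup G H"
      using is_group H(1) finH commH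
      by (simp add: finite_abelian_subgroup_def finite_abelian_subgroup_axioms_def commutative_on_def)
    show "\<exists>!t. t \<in> H \<and> inv t \<otimes> g \<in> ?K" if "g \<in> carrier G" for g
      using decomp[OF that] uniq[OF _ _ that] by blast
  qed (fact is_group fin conj fpf \<open>?K \<noteq> {\<one>}\<close> H(4))+
qed

end

theorem theorem3p4:
  fixes G (structure) and H :: "'a set" and h k :: nat
  assumes "group G" and "finite (carrier G)"
    and "frobenius_complement H G"
    and "comm_group (G\<lparr>carrier := H\<rparr>)"
    and "commutative_on (frobenius_kernel H G) G"
    and "h = card H" and "k = card (frobenius_kernel H G)"
  shows "AM_Z G =
    1 + 2 * ((real h ^ 2 - 1) / real h) * (1 - (real h - 1) / real k) * (1 - 1 / real k)"
proof -
  have "commutative_on H G"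
    unfolding commutative_on_def using comm_monoid.m_comm[OF comm_group.axioms(1)[OF assms(4)]] by simp
  then interpret frobenius_pair G "frobenius_kernel H G" H
    using assms by (intro group.frobenius_pairI)
  show ?thesis using AM_Z_eq assms by simp
qed

end
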